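(* Let $c(n)=\sum_{0\le r,s,t\le n}\frac{n!}{r!\,s!\,t!\,(n-r-s-t)!}r^{n-r-s-t}s^{n-r-s+1}$ (with $0^0=1$, $1/m!=0$ for negative $m$). Then $$c(n)\sim F(r_n,s_n,t_n)\,\frac{(2\pi)^{3/2}r_ns_n\sqrt{t_n}}{n},\qquad n\to\infty,$$ where $(r_n,s_n,t_n)$ is, for large $n$, the unique solution with $r,s,t>0$, $r+s+t<n$ of the system $$-\log r-\log s+\frac{n-r-s-t}{r}-\psi(r+1)+\psi(n-r-s-t+1)=0,$$ $$-\log r-\log s+\frac{n-r-s+1}{s}-\psi(s+1)+\psi(n-r-s-t+1)=0,$$ $$-\log r-\psi(t+1)+\psi(n-r-s-t+1)=0.$$
   Context: $\psi=\Gamma'/\Gamma$ is the digamma function. For given $n$, $F(r,s,t)=\dfrac{\Gamma(n+1)\,r^{n-r-s-t}\,s^{n-r-s+1}}{\Gamma(r+1)\Gamma(s+1)\Gamma(t+1)\Gamma(n-r-s-t+1)}$ for real $r,s,t\ge0$ with $r+s+t\le n$. *)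

theory Defs
  imports "HOL-Analysis.Analysis" "HOL-Library.Landau_Symbols"
begin

text \<open>
  Summands with \<open>r + s + t > n\<close> carry the factor \<open>1 / (n - r - s - t)! = 0\<close>; the explicit
  conditional avoids truncated subtraction.
\<close>

definition c_sum :: "nat \<Rightarrow> real" where
  "c_sum n = (\<Sum>r=0..n. \<Sum>s=0..n. \<Sum>t=0..n.
     if r + s + t \<le> n
     then fact n / (fact r * fact s * fact t * fact (n - r - s - t))
            * real r ^ (n - r - s - t) * real s ^ (n - r - s + 1)
     else 0)"

text \<open>Real power with \<open>0\<^sup>0 = 1\<close>, whereas \<open>0 powr 0 = 0\<close>.\<close>

definition rpow :: "real \<Rightarrow> real \<Rightarrow> real" where
  "rpow x y = (if x = 0 \<and> y = 0 then 1 else x powr y)"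

definition F_term :: "nat \<Rightarrow> real \<Rightarrow> real \<Rightarrow> real \<Rightarrow> real" where
  "F_term n r s t =
     Gamma (real n + 1) * rpow r (real n - r - s - t) * rpow s (real n - r - s + 1)
     / (Gamma (r + 1) * Gamma (s + 1) * Gamma (t + 1) * Gamma (real n - r - s - t + 1))"

definition critical :: "nat \<Rightarrow> real \<Rightarrow> real \<Rightarrow> real \<Rightarrow> bool" where
  "critical n r s t \<longleftrightarrow>
     r > 0 \<and> s > 0 \<and> t > 0 \<and> r + s + t < real n \<and>
     - ln r - ln s + (real n - r - s - t) / r
       - Digamma (r + 1) + Digamma (real n - r - s - t + 1) = 0 \<and>
     - ln r - ln s + (real n - r - s + 1) / s
       - Digamma (s + 1) + Digamma (real n - r - s - t + 1) = 0 \<and>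
     - ln r - Digamma (t + 1) + Digamma (real n - r - s - t + 1) = 0"

end

theory Submission
  imports Defs "HOL-Real_Asymp.Real_Asymp" "HOL-Probability.Distributions"
begin

text \<open>
  Summing over \<open>t\<close> by the binomial theorem turns \<open>c(n)\<close> into a double sum whose summand
  \<open>n! / (r! s! m!) (1 + r)\<^sup>m s\<^bsup>m + 1\<^esup>\<close>, \<open>m = n - r - s\<close>, is log-concave in the real variables
  \<open>(r, s)\<close>. At \<open>(r\<^sub>n, s\<^sub>n)\<close> its logarithmic gradient is \<open>O(1/r\<^sub>n)\<close>, and after rescaling by
  \<open>r\<^sub>n/\<surd>n\<close> and \<open>s\<^sub>n/\<surd>n\<close> its logarithmic Hessian tends to minus the identity; log-concavity supplies
  the domination, so the rescaled sum tends to the Gaussian integral \<open>2\<pi>\<close>. Stirling's formula then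
  identifies the summand at \<open>(r\<^sub>n, s\<^sub>n)\<close> with \<open>F(r\<^sub>n, s\<^sub>n, t\<^sub>n) \<surd>(2\<pi>t\<^sub>n)\<close>.

  The system forces \<open>r < s = o(n)\<close> and \<open>t = O(log n)\<close>, hence all its solutions lie in a half-space on
  which \<open>log F\<close> is strictly concave; this gives uniqueness. Existence follows from Brouwer's theorem
  on a box with \<open>r, s\<close> of order \<open>n / log n\<close> and \<open>t\<close> between \<open>log n / 4\<close> and \<open>(log n)\<^sup>2\<close>.
\<close>

section \<open>Bounds for the digamma function and Stirling's formula\<close>

text \<open>Laplace's method is not applied to the triple sum directly, because the variable
  \<open>t\<close> has a scale of its own: \<open>t_n\<close> grows only logarithmically, and
  concavity of ln F is available on a half-space only. Summing out \<open>t\<close> exactly leaves a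
  summand in two variables that is log-concave on its whole domain. The price is that the given
  system expresses stationarity of F and not of the new summand. The mismatch is the gradient of
  size O(1/r_n); over a Gaussian window of widths r_n/sqrt n and s_n/sqrt n it changes the logarithm
  by O(1/sqrt n) + O((s_n/n)(sqrt n/r_n)), which tends to 0. The constant (2 pi)^(3/2) is thus
  assembled from two sources: 2 pi from the Gaussian in the plane, and sqrt(2 pi) from Stirling's
  formula applied to the summation over \<open>t\<close>. Along a critical sequence the limits rest
  on a few inequalities, such as s_n = o(n), n - r_n - s_n - t_n = O(r_n log n), and the near
  equality of n - r_n - s_n - t_n and r_n t_n, rather than on an expansion of (r_n, s_n,
  t_n).\<close>

lemma ln_Gamma_plus1_real:
  fixes x :: real
  assumes "x > 0"
  shows "ln_Gamma (x + 1) = ln_Gamma x + ln x"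
proof -
  have "Gamma (x + 1) = x * Gamma x" by (rule Gamma_plus1) (use assms in auto)
  then show ?thesis
    using assms ln_mult_pos[OF assms Gamma_real_pos[OF assms]] by (simp add: ln_Gamma_real_pos)
qed

text \<open>\<open>ln x\<close> is the increment of \<open>ln_Gamma\<close> over [x, x + 1]. By the
  mean value theorem it equals \<open>Digamma z\<close> for some z in between, and
  \<open>Digamma\<close> is increasing.\<close>

lemma Digamma_bounds_real:
  fixes x :: real
  assumes "x > 0"
  shows Digamma_le_ln: "Digamma x \<le> ln x" and ln_le_Digamma_plus1: "ln x \<le> Digamma (x + 1)"
proof -
  have "\<exists>z. z > x \<and> z < x + 1 \<and> ln_Gamma (x + 1) - ln_Gamma x = (x + 1 - x) * Digamma z"
    by (rule MVT2) (use assms in \<open>auto intro!: derivative_eq_intros\<close>)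
  then obtain z where z: "x < z" "z < x + 1" "ln x = Digamma z"
    using ln_Gamma_plus1_real[OF assms] by auto
  then show "Digamma x \<le> ln x" "ln x \<le> Digamma (x + 1)"
    using assms Digamma_real_mono[of x z] Digamma_real_mono[of z "x + 1"] by auto
qed

text \<open>The same argument one derivative higher: 1/x is the increment of \<open>Digamma\<close>,
  and \<open>Polygamma 1\<close> is decreasing. These bounds carry the second-derivative estimates
  below.\<close>

lemma Trigamma_bounds_real:
  fixes x :: real
  assumes "x > 0"
  shows Trigamma_ge: "1 / x \<le> Polygamma 1 x" and Trigamma_plus1_le: "Polygamma 1 (x + 1) \<le> 1 / x"
proof -
  have "\<exists>z. z > x \<and> z < x + 1 \<and> Digamma (x + 1) - Digamma x = (x + 1 - x) * Polygamma 1 z"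
    by (rule MVT2) (use assms in \<open>auto intro!: derivative_eq_intros\<close>)
  then obtain z where z: "x < z" "z < x + 1" "1 / x = Polygamma 1 z"
    using Digamma_plus1[of x] assms by auto
  then show "1 / x \<le> Polygamma 1 x" "Polygamma 1 (x + 1) \<le> 1 / x"
    using assms Polygamma_real_strict_antimono[of x z 1]
      Polygamma_real_strict_antimono[of z "x + 1" 1] by auto
qed

text \<open>Serves to pin down the constant in Stirling's formula. It is the complex duplication
  formula on the positive reals, where all Gamma values are positive and logarithms may be
  taken.\<close>

lemma Gamma_legendre_duplication_real:
  fixes x :: real
  assumes "x > 0"
  shows "ln_Gamma x + ln_Gamma (x + 1/2) = (1 - 2 * x) * ln 2 + ln pi / 2 + ln_Gamma (2 * x)"
proof -
  have "complex_of_real x \<notin> \<int>\<^sub>\<le>\<^sub>0" "complex_of_real x + 1/2 \<notin> \<int>\<^sub>\<le>\<^sub>0"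
    using assms by (auto elim!: nonpos_Ints_cases simp: complex_eq_iff)
  from Gamma_legendre_duplication[OF this]
  have "complex_of_real (Gamma x * Gamma (x + 1/2)) =
          complex_of_real (exp ((1 - 2 * x) * ln 2) * sqrt pi * Gamma (2 * x))"
    by (simp add: Gamma_complex_of_real [symmetric] exp_of_real [symmetric] mult_ac)
  then have "Gamma x * Gamma (x + 1/2) = exp ((1 - 2 * x) * ln 2) * sqrt pi * Gamma (2 * x)"
    using of_real_eq_iff by blast
  then have "ln (Gamma x * Gamma (x + 1/2)) = ln (exp ((1 - 2 * x) * ln 2) * sqrt pi * Gamma (2 * x))"
    by simp
  moreover have "Gamma x > 0" "Gamma (x + 1/2) > 0" "Gamma (2 * x) > 0"
    using assms by (auto intro!: Gamma_real_pos)
  ultimately show ?thesis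
    using assms by (simp add: ln_mult ln_Gamma_real_pos ln_sqrt)
qed

text \<open>The constant of Stirling's formula is not subtracted, so the limit is ln(2 pi)/2 and not
  0.\<close>

definition stirling_err :: "real \<Rightarrow> real" where
  "stirling_err x = ln_Gamma (x + 1) - ((x + 1/2) * ln x - x)"

lemma stirling_err_has_deriv:
  assumes "x > 0"
  shows "(stirling_err has_real_derivative (Digamma (x + 1) - ln x - 1 / (2 * x))) (at x)"
  unfolding stirling_err_def
  by (rule derivative_eq_intros refl | use assms in \<open>simp add: field_simps\<close>)+

text \<open>The derivative at z is at most 1/(2z) in absolute value, since
  \<open>Digamma (z + 1)\<close> lies between ln z and ln z + 1/z. The estimate is used to pass from
  integer to real arguments.\<close>

lemma stirling_err_lipschitz:
  assumes "1 \<le> a" "a \<le> x" "x \<le> a + 1"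
  shows "\<bar>stirling_err x - stirling_err a\<bar> \<le> 1 / a"
proof (cases "a = x")
  case False
  then have "a < x" using assms by simp
  then have "\<exists>z. z > a \<and> z < x \<and> stirling_err x - stirling_err a =
      (x - a) * (Digamma (z + 1) - ln z - 1 / (2 * z))"
    by (intro MVT2 stirling_err_has_deriv) (use assms in auto)
  then obtain z where z: "a < z" "z < x" "stirling_err x - stirling_err a =
      (x - a) * (Digamma (z + 1) - ln z - 1 / (2 * z))" by auto
  have "z > 0" using z assms by simp
  have "ln (z + 1) - ln z = ln (1 + 1 / z)"
    using \<open>z > 0\<close> ln_div[of "z + 1" z] by (simp add: field_simps)
  also have "\<dots> \<le> 1 / z" using \<open>z > 0\<close> by (intro ln_add_one_self_le_self) auto
  finally have ln: "ln (z + 1) - ln z \<le> 1 / z" .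
  have "Digamma (z + 1) \<le> ln (z + 1)" "ln z \<le> Digamma (z + 1)"
    using \<open>z > 0\<close> by (auto intro!: Digamma_le_ln ln_le_Digamma_plus1)
  then have "\<bar>Digamma (z + 1) - ln z - 1 / (2 * z)\<bar> \<le> 1 / z"
    using ln \<open>z > 0\<close> by (simp add: abs_le_iff)
  also have "\<dots> \<le> 1 / a" using z assms by (simp add: field_simps)
  finally have "\<bar>Digamma (z + 1) - ln z - 1 / (2 * z)\<bar> \<le> 1 / a" .
  then have "\<bar>x - a\<bar> * \<bar>Digamma (z + 1) - ln z - 1 / (2 * z)\<bar> \<le> 1 * (1 / a)"
    using assms by (intro mult_mono) auto
  then show ?thesis using z(3) by (simp add: abs_mult)
qed (use assms in auto)

text \<open>The increments are O(1/n^2), hence summable. This gives the existence of the limit but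
  not its value.\<close>

lemma convergent_stirling_err_nat: "convergent (\<lambda>n. stirling_err (real n))"
proof -
  have "(\<lambda>n. stirling_err (real (Suc n)) - stirling_err (real n)) \<in>
          O(\<lambda>n::nat. 1 - (real n + 1/2) * ln (1 + 1 / real n))"
  proof (rule bigoI[where c = 1], use eventually_gt_at_top[of "0::nat"] in eventually_elim)
    case (elim n)
    have "ln (1 + real n) = ln (real n) + ln (1 + 1 / real n)"
      using elim ln_div[of "1 + real n" "real n"] by (simp add: field_simps)
    then show ?case
      using ln_Gamma_plus1_real[of "real n + 1"] elim
      by (simp add: stirling_err_def algebra_simps)
  qed
  also have "(\<lambda>n::nat. 1 - (real n + 1/2) * ln (1 + 1 / real n)) \<in> O(\<lambda>n. real n powr (-2))"
    by real_asymp
  finally have "summable (\<lambda>n. stirling_err (real (Suc n)) - stirling_err (real n))"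
    by (rule summable_comparison_test_bigo[rotated]) (simp add: summable_real_powr_iff)
  then have "convergent (\<lambda>n. \<Sum>k<n. stirling_err (real (Suc k)) - stirling_err (real k))"
    by (simp add: summable_iff_convergent)
  then have "convergent (\<lambda>n. stirling_err (real n) - stirling_err (real 0))"
    using sum_lessThan_telescope[of "\<lambda>n. stirling_err (real n)"] by simp
  then show ?thesis by (simp only: convergent_diff_const_right_iff)
qed

text \<open>Comparison with the floor carries the limit C over to real arguments. The duplication
  formula links the values at 2x, x - 1/2 and x so that C enters as C - C - C; this is a nontrivial
  linear equation and determines C.\<close>

lemma tendsto_stirling_err: "(stirling_err \<longlongrightarrow> ln (2 * pi) / 2) at_top"
proof -
  obtain C where C: "(\<lambda>n. stirling_err (real n)) \<longlonglongrightarrow> C"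
    using convergent_stirling_err_nat by (auto simp: convergent_def)
  have fl: "filterlim (\<lambda>x::real. nat \<lfloor>x\<rfloor>) at_top at_top"
    by (rule filterlim_compose[OF filterlim_nat_sequentially filterlim_floor_sequentially])
  have "((\<lambda>x::real. stirling_err (real (nat \<lfloor>x\<rfloor>))) \<longlongrightarrow> C) at_top"
    by (rule filterlim_compose[OF C fl])
  moreover have "((\<lambda>x. stirling_err x - stirling_err (real (nat \<lfloor>x\<rfloor>))) \<longlongrightarrow> 0) at_top"
  proof (rule tendsto_0_le[where K = 1])
    show "((\<lambda>x::real. 1 / real (nat \<lfloor>x\<rfloor>)) \<longlongrightarrow> 0) at_top"
      by (rule filterlim_compose[OF lim_1_over_n fl])
    show "\<forall>\<^sub>F x in at_top. norm (stirling_err x - stirling_err (real (nat \<lfloor>x\<rfloor>)))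
        \<le> norm (1 / real (nat \<lfloor>x\<rfloor>)) * 1"
      using eventually_ge_at_top[of 1]
    proof eventually_elim
      case (elim x)
      then show ?case
        using stirling_err_lipschitz[of "real (nat \<lfloor>x\<rfloor>)" x] by (simp add: floor_correct)
    qed
  qed
  ultimately have "((\<lambda>x. stirling_err (real (nat \<lfloor>x\<rfloor>)) +
      (stirling_err x - stirling_err (real (nat \<lfloor>x\<rfloor>)))) \<longlongrightarrow> C + 0) at_top"
    by (rule tendsto_add)
  then have lim: "(stirling_err \<longlongrightarrow> C) at_top" by simp
  have l1: "((\<lambda>x. stirling_err (2 * x)) \<longlongrightarrow> C) at_top"
    by (rule filterlim_compose[OF lim]) real_asymp
  have l2: "((\<lambda>x. stirling_err (x - 1/2)) \<longlongrightarrow> C) at_top"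
    by (rule filterlim_compose[OF lim]) real_asymp
  \<comment> \<open>The duplication formula at \<open>x + 1/2\<close>, with the logarithmic main terms moved to one side.\<close>
  have "\<forall>\<^sub>F x in at_top. stirling_err (2 * x) - stirling_err (x - 1/2) - stirling_err x =
      x * ln (x - 1/2) - x * ln x + 1/2 - ln 2 / 2 - ln pi / 2"
    using eventually_gt_at_top[of "1::real"]
  proof eventually_elim
    case (elim x)
    have "ln (2 * x) = ln 2 + ln x" using elim by (simp add: ln_mult)
    then show ?case
      using Gamma_legendre_duplication_real[of "x + 1/2"] elim
      by (simp add: stirling_err_def algebra_simps)
  qed
  then have "((\<lambda>x. x * ln (x - 1/2) - x * ln x + 1/2 - ln 2 / 2 - ln pi / 2) \<longlongrightarrow> C - C - C) at_top"
    by (rule Lim_transform_eventually[OF tendsto_diff[OF tendsto_diff[OF l1 l2] lim]])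
  moreover have "((\<lambda>x::real. x * ln (x - 1/2) - x * ln x + 1/2 - ln 2 / 2 - ln pi / 2) \<longlongrightarrow>
      - ln pi / 2 - ln 2 / 2) at_top"
  proof -
    have "((\<lambda>x::real. x * ln (x - 1/2) - x * ln x) \<longlongrightarrow> -1/2) at_top" by real_asymp
    then have "((\<lambda>x::real. (x * ln (x - 1/2) - x * ln x) + (1/2 - ln 2 / 2 - ln pi / 2)) \<longlongrightarrow>
      - 1/2 + (1/2 - ln 2 / 2 - ln pi / 2)) at_top" by (intro tendsto_add tendsto_const)
    then show ?thesis by (simp add: algebra_simps)
  qed
  ultimately have "C - C - C = - ln pi / 2 - ln 2 / 2"
    by (rule tendsto_unique[rotated]) simp
  then have "C = ln (2 * pi) / 2" by (simp add: ln_mult)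
  with lim show ?thesis by simp
qed

section \<open>Summation over \<open>t\<close> and log-concavity\<close>

text \<open>The term \<open>ln (1 + r)\<close> keeps this finite on the edge r = 0, whereas
  \<open>ln s\<close> confines it to s > 0.\<close>

definition log_summand :: "real \<Rightarrow> real \<Rightarrow> real \<Rightarrow> real" where
  "log_summand N r s = ln_Gamma (N + 1) + (N - r - s) * ln (1 + r) + (N - r - s + 1) * ln s
     - ln_Gamma (r + 1) - ln_Gamma (s + 1) - ln_Gamma (N - r - s + 1)"

lemma sum_binomial_fact:
  fixes x :: real
  shows "(\<Sum>t\<le>m. x ^ (m - t) / (fact t * fact (m - t))) = (1 + x) ^ m / fact m"
proof -
  have "(1 + x) ^ m = (\<Sum>t\<le>m. of_nat (m choose t) * 1 ^ t * x ^ (m - t))"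
    by (rule binomial_ring)
  also have "\<dots> = (\<Sum>t\<le>m. fact m * (x ^ (m - t) / (fact t * fact (m - t))))"
    by (intro sum.cong) (auto simp: binomial_fact)
  also have "\<dots> = fact m * (\<Sum>t\<le>m. x ^ (m - t) / (fact t * fact (m - t)))"
    by (rule sum_distrib_left [symmetric])
  finally show ?thesis by simp
qed

lemma c_sum_eq_double_sum:
  "c_sum n = (\<Sum>r=0..n. \<Sum>s=0..n. if 0 < s \<and> r + s \<le> n
                then exp (log_summand (real n) (real r) (real s)) else 0)"
  unfolding c_sum_def
proof (intro sum.cong refl)
  fix r s :: nat
  define m where "m = n - r - s"
  have "(\<Sum>t=0..n. if r + s + t \<le> n
     then fact n / (fact r * fact s * fact t * fact (n - r - s - t))
            * real r ^ (n - r - s - t) * real s ^ (n - r - s + 1) else 0) =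
        (if r + s \<le> n then fact n / (fact r * fact s) * real s ^ (m + 1) * ((1 + real r) ^ m / fact m) else 0)"
  proof (cases "r + s \<le> n")
    case True
    have "(\<Sum>t=0..n. if r + s + t \<le> n
       then fact n / (fact r * fact s * fact t * fact (n - r - s - t))
            * real r ^ (n - r - s - t) * real s ^ (n - r - s + 1) else 0) =
        (\<Sum>t\<in>{0..n} \<inter> {t. r + s + t \<le> n}. fact n / (fact r * fact s * fact t * fact (n - r - s - t))
            * real r ^ (n - r - s - t) * real s ^ (n - r - s + 1))"
      by (simp add: sum.If_cases)
    also have "{0..n} \<inter> {t. r + s + t \<le> n} = {..m}" using True by (auto simp: m_def)
    also have "(\<Sum>t\<le>m. fact n / (fact r * fact s * fact t * fact (n - r - s - t))
            * real r ^ (n - r - s - t) * real s ^ (n - r - s + 1)) =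
         (\<Sum>t\<le>m. fact n / (fact r * fact s) * real s ^ (m + 1) *
            (real r ^ (m - t) / (fact t * fact (m - t))))"
      by (intro sum.cong refl) (simp add: m_def mult_ac)
    finally show ?thesis using True by (simp only: sum_distrib_left [symmetric] sum_binomial_fact if_True)
  next
    case False
    then show ?thesis by (simp del: of_nat_Suc)
  qed
  also have "\<dots> = (if 0 < s \<and> r + s \<le> n then exp (log_summand (real n) (real r) (real s)) else 0)"
  \<comment> \<open>For s = 0 the left side vanishes because the exponent m + 1 is at least 1. This
    is what allows the restriction to s > 0, where \<open>ln s\<close> is meaningful.\<close>
  proof (cases "0 < s \<and> r + s \<le> n")
    case True
    then have m: "real n - real r - real s = real m" by (simp add: m_def of_nat_diff)
    have e: "exp (real k * ln x) = x ^ k" if "x > 0" for k x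
      using that by (simp add: exp_of_nat_mult)
    have G: "exp (ln_Gamma (real k + 1)) = fact k" for k
      using Gamma_real_pos_exp[of "real k + 1"] Gamma_fact[of k, where 'a = real] by (simp add: add_ac)
    have "exp (log_summand (real n) (real r) (real s)) =
        fact n * (1 + real r) ^ m * real s ^ (m + 1) / fact r / fact s / fact m"
      using True e[of "1 + real r" m] e[of "real s" "m + 1"]
      unfolding log_summand_def m exp_add exp_diff G by (simp add: add_ac)
    then show ?thesis using True by simp
  qed auto
  finally show "(\<Sum>t=0..n. if r + s + t \<le> n
     then fact n / (fact r * fact s * fact t * fact (n - r - s - t))
            * real r ^ (n - r - s - t) * real s ^ (n - r - s + 1) else 0) =
    (if 0 < s \<and> r + s \<le> n then exp (log_summand (real n) (real r) (real s)) else 0)" .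
qed

section \<open>First and second derivatives of the log-summand along a direction (a, b), and its
  concavity\<close>

definition log_summand_d1 :: "real \<Rightarrow> real \<Rightarrow> real \<Rightarrow> real \<Rightarrow> real \<Rightarrow> real" where
  "log_summand_d1 N a b r s = - (a + b) * (ln (1 + r) + ln s) + (N - r - s) * a / (1 + r)
     + (N - r - s + 1) * b / s - a * Digamma (r + 1) - b * Digamma (s + 1)
     + (a + b) * Digamma (N - r - s + 1)"

definition log_summand_d2 :: "real \<Rightarrow> real \<Rightarrow> real \<Rightarrow> real \<Rightarrow> real \<Rightarrow> real" where
  "log_summand_d2 N a b r s = - 2 * (a + b) * (a / (1 + r) + b / s)
     - (N - r - s) * (a / (1 + r))\<^sup>2 - (N - r - s + 1) * (b / s)\<^sup>2
     - a\<^sup>2 * Polygamma 1 (r + 1) - b\<^sup>2 * Polygamma 1 (s + 1)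
     - (a + b)\<^sup>2 * Polygamma 1 (N - r - s + 1)"

lemma not_nonpos_Ints_pos_real: "(x::real) > 0 \<Longrightarrow> x \<notin> \<int>\<^sub>\<le>\<^sub>0"
  by (auto elim!: nonpos_Ints_cases)

lemma log_summand_deriv1:
  assumes "r + x * a > - 1" "s + x * b > 0" "N - (r + x * a) - (s + x * b) > - 1"
  shows "((\<lambda>x. log_summand N (r + x * a) (s + x * b)) has_real_derivative
           log_summand_d1 N a b (r + x * a) (s + x * b)) (at x)"
proof -
  have "1 + (r + x * a) \<noteq> 0" "s + x * b \<noteq> 0" using assms by auto
  then show ?thesis
    unfolding log_summand_def log_summand_d1_def
    using assms
    by (auto intro!: derivative_eq_intros simp: add_ac diff_divide_distrib add_divide_distrib algebra_simps)
qed

lemma log_summand_deriv2: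
  assumes "r + x * a > - 1" "s + x * b > 0" "N - (r + x * a) - (s + x * b) > - 1"
  shows "((\<lambda>x. log_summand_d1 N a b (r + x * a) (s + x * b)) has_real_derivative
           log_summand_d2 N a b (r + x * a) (s + x * b)) (at x)"
proof -
  have nz: "1 + (r + x * a) \<noteq> 0" "s + x * b \<noteq> 0" using assms by auto
  have np: "r + x * a + 1 \<notin> \<int>\<^sub>\<le>\<^sub>0" "s + x * b + 1 \<notin> \<int>\<^sub>\<le>\<^sub>0"
    "N - (r + x * a) - (s + x * b) + 1 \<notin> \<int>\<^sub>\<le>\<^sub>0"
    using assms by (auto intro!: not_nonpos_Ints_pos_real)
  define A B where "A = 1 + (r + x * a)" and "B = s + x * b"
  have *: "((\<lambda>x. log_summand_d1 N a b (r + x * a) (s + x * b)) has_real_derivative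
     (- (a + b) * (a / A + b / B)
      + (- (a + b) * a * A - (N - (r + x * a) - (s + x * b)) * a * a) / (A * A)
      + (- (a + b) * b * B - (N - (r + x * a) - (s + x * b) + 1) * b * b) / (B * B)
      - a * (Polygamma 1 (r + x * a + 1) * a)
      - b * (Polygamma 1 (s + x * b + 1) * b)
      + (a + b) * (Polygamma 1 (N - (r + x * a) - (s + x * b) + 1) * (- (a + b))))) (at x)"
    unfolding log_summand_d1_def A_def B_def
    by (rule derivative_eq_intros refl assms nz np | use assms in \<open>simp; fail\<close> | simp add: algebra_simps)+
  have "A \<noteq> 0" "B \<noteq> 0" using nz by (auto simp: A_def B_def)
  then have 1: "(- (a + b) * a * A - M * a * a) / (A * A) = - (a + b) * (a / A) - M * (a / A)\<^sup>2"
    "(- (a + b) * b * B - M * b * b) / (B * B) = - (a + b) * (b / B) - M * (b / B)\<^sup>2" for M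
    by (simp_all add: field_simps power2_eq_square)
  show ?thesis
    by (rule DERIV_cong[OF *], unfold 1 log_summand_d2_def A_def[symmetric] B_def[symmetric])
       (simp add: algebra_simps power2_eq_square)
qed

text \<open>With X = a/(1+r), Y = b/s, m = N - r - s and p the trigamma value at m + 1, the only
  term of -d2 that can be negative is 2(a+b)(X+Y), and only if ab < 0. Completing the square with
  (a+b)^2 p costs (X+Y)^2/p, which is at most (m+1)(X+Y)^2, hence at most (m+1)(X^2+Y^2) because XY
  <= 0. The form offers m X^2 + (m+1) Y^2; the one missing X^2 is supplied by a^2
  \<open>Polygamma 1 (r + 1)\<close>, which is at least a^2/(1+r).\<close>

lemma log_summand_d2_nonpos:
  assumes "r \<ge> 0" "s > 0" "N - r - s \<ge> 0"
  shows "log_summand_d2 N a b r s \<le> 0"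
proof -
  define m where "m = N - r - s"
  define A X Y p where "A = 1 / (1 + r)" and "X = a / (1 + r)" and "Y = b / s" and "p = Polygamma 1 (m + 1)"
  have m: "m \<ge> 0" and p: "p \<ge> 1 / (m + 1)" using assms Trigamma_ge[of "m + 1"] by (auto simp: m_def p_def)
  have p0: "p > 0" using p m by (smt (verit) divide_pos_pos)
  have A: "A > 0" "A \<le> 1" "X = a * A" using assms by (auto simp: A_def X_def)
  have pr: "Polygamma 1 (r + 1) \<ge> A" using assms Trigamma_ge[of "r + 1"] by (simp add: A_def add_ac)
  have ps: "Polygamma 1 (s + 1) \<ge> 0" using assms by (intro less_imp_le Polygamma_real_odd_pos) (auto intro!: not_nonpos_Ints_pos_real)
  have "a\<^sup>2 * Polygamma 1 (r + 1) \<ge> a\<^sup>2 * A" using pr by (intro mult_left_mono) auto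
  moreover have "b\<^sup>2 * Polygamma 1 (s + 1) \<ge> 0" using ps by simp
  moreover have "2 * (a + b) * (X + Y) + m * X\<^sup>2 + (m + 1) * Y\<^sup>2 + a\<^sup>2 * A + (a + b)\<^sup>2 * p \<ge> 0"
  proof (cases "a * b \<ge> 0")
    case True
    have "(a + b) * (X + Y) = A * a\<^sup>2 + b\<^sup>2 / s + a * b * (A + 1 / s)"
      by (simp add: A(3) Y_def power2_eq_square algebra_simps add_divide_distrib)
    also have "\<dots> \<ge> 0"
      using A assms mult_nonneg_nonneg[OF True, of "A + 1 / s"] by (intro add_nonneg_nonneg) auto
    finally have "0 \<le> (a + b) * (X + Y)" .
    moreover have "m * X\<^sup>2 \<ge> 0" "(m + 1) * Y\<^sup>2 \<ge> 0" "a\<^sup>2 * A \<ge> 0" "(a + b)\<^sup>2 * p \<ge> 0" using m A p0 by auto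
    ultimately show ?thesis by linarith
  next
    case False
    have "X * Y = a * b * (A / s)" by (simp add: A(3) Y_def)
    also have "\<dots> \<le> 0" using False A assms mult_nonpos_nonneg[of "a * b" "A / s"] by auto
    finally have XY: "X * Y \<le> 0" .
    have "(X + Y)\<^sup>2 / p \<le> (X + Y)\<^sup>2 * (m + 1)"
    proof -
      have "1 / p \<le> m + 1" using p p0 m by (simp add: field_simps)
      then have "(X + Y)\<^sup>2 * (1 / p) \<le> (X + Y)\<^sup>2 * (m + 1)" by (intro mult_left_mono) auto
      then show ?thesis by simp
    qed
    also have "\<dots> = (m + 1) * X\<^sup>2 + (m + 1) * Y\<^sup>2 + 2 * (m + 1) * (X * Y)"
      by (simp add: power2_eq_square algebra_simps)
    also have "\<dots> \<le> (m + 1) * X\<^sup>2 + (m + 1) * Y\<^sup>2" using XY m by (simp add: mult_nonneg_nonpos)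
    also have "\<dots> \<le> m * X\<^sup>2 + (m + 1) * Y\<^sup>2 + a\<^sup>2 * A"
    proof -
      have "a\<^sup>2 * A * A \<le> a\<^sup>2 * A * 1" using A by (intro mult_left_mono) auto
      then show ?thesis by (simp add: A(3) power2_eq_square algebra_simps)
    qed
    finally have "(X + Y)\<^sup>2 / p \<le> m * X\<^sup>2 + (m + 1) * Y\<^sup>2 + a\<^sup>2 * A" .
    moreover have "(a + b)\<^sup>2 * p + 2 * (a + b) * (X + Y) + (X + Y)\<^sup>2 / p = p * (a + b + (X + Y) / p)\<^sup>2"
      using p0 by (simp add: power2_eq_square field_simps)
    moreover have "p * (a + b + (X + Y) / p)\<^sup>2 \<ge> 0" using p0 by simp
    ultimately show ?thesis by linarith
  qed
  ultimately show ?thesis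
    unfolding log_summand_d2_def m_def[symmetric] X_def[symmetric] Y_def[symmetric] p_def[symmetric] by linarith
qed

lemma log_summand_concave_on_segment:
  assumes "r \<ge> 0" "s > 0" "r + s \<le> N" "r' \<ge> 0" "s' > 0" "r' + s' \<le> N" "0 \<le> x" "x \<le> 1"
  shows "(1 - x) * log_summand N r s + x * log_summand N r' s'
           \<le> log_summand N (r + x * (r' - r)) (s + x * (s' - s))"
proof -
  define a b where "a = r' - r" and "b = s' - s"
  have dom: "r + y * a \<ge> 0 \<and> s + y * b > 0 \<and> N - (r + y * a) - (s + y * b) \<ge> 0" if "0 \<le> y" "y \<le> 1" for y
  proof -
    have e: "r + y * a = (1 - y) * r + y * r'" "s + y * b = (1 - y) * s + y * s'"
      by (simp_all add: a_def b_def algebra_simps)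
    have "(1 - y) * (N - r - s) + y * (N - r' - s') \<ge> 0" using that assms by (intro add_nonneg_nonneg mult_nonneg_nonneg) auto
    then have "N - (r + y * a) - (s + y * b) \<ge> 0" unfolding e by (simp add: algebra_simps)
    moreover have "(1 - y) * s + y * s' > 0"
      using that assms by (cases "y = 0") (auto intro!: add_nonneg_pos mult_nonneg_nonneg)
    ultimately show ?thesis using that assms unfolding e by auto
  qed
  have "convex_on {0..1} (\<lambda>y. - log_summand N (r + y * a) (s + y * b))"
  proof (rule f''_ge0_imp_convex)
    fix y :: real assume y: "y \<in> {0..1}"
    then have d: "r + y * a \<ge> 0" "s + y * b > 0" "N - (r + y * a) - (s + y * b) \<ge> 0" using dom[of y] by auto
    show "((\<lambda>y. - log_summand N (r + y * a) (s + y * b)) has_real_derivative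
        - log_summand_d1 N a b (r + y * a) (s + y * b)) (at y)"
      by (intro derivative_intros log_summand_deriv1) (use d in auto)
    show "((\<lambda>y. - log_summand_d1 N a b (r + y * a) (s + y * b)) has_real_derivative
        - log_summand_d2 N a b (r + y * a) (s + y * b)) (at y)"
      by (intro derivative_intros log_summand_deriv2) (use d in auto)
    show "0 \<le> - log_summand_d2 N a b (r + y * a) (s + y * b)"
      using log_summand_d2_nonpos[OF d] by simp
  qed simp
  from convex_onD[OF this, of x 0 1] show ?thesis using assms by (simp add: a_def b_def)
qed

text \<open>Maclaurin's formula in the parameter of the segment. The intermediate point y is
  uncontrolled, so the Hessian limit is later taken along an arbitrary bounded sequence of such
  points.\<close>

lemma log_summand_taylor:
  assumes "\<And>y. 0 \<le> y \<Longrightarrow> y \<le> 1 \<Longrightarrow> r + y * a > - 1 \<and> s + y * b > 0 \<and> N - (r + y * a) - (s + y * b) > - 1"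
  obtains y where "0 < y" "y < 1"
    "log_summand N (r + a) (s + b) = log_summand N r s + log_summand_d1 N a b r s
        + log_summand_d2 N a b (r + y * a) (s + y * b) / 2"
proof -
  let ?f = "\<lambda>y. log_summand N (r + y * a) (s + y * b)"
  let ?D = "\<lambda>k::nat. if k = 0 then ?f else if k = 1 then (\<lambda>y. log_summand_d1 N a b (r + y * a) (s + y * b))
     else (\<lambda>y. log_summand_d2 N a b (r + y * a) (s + y * b))"
  have "\<exists>t>0. t < 1 \<and> ?f 1 = (\<Sum>m<2. ?D m 0 / fact m * 1 ^ m) + ?D 2 t / fact 2 * 1 ^ 2"
  proof (rule Maclaurin)
    show "\<forall>m t. m < 2 \<and> 0 \<le> t \<and> t \<le> 1 \<longrightarrow> (?D m has_real_derivative ?D (Suc m) t) (at t)"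
    proof safe
      fix m :: nat and t :: real assume "m < 2" "0 \<le> t" "t \<le> 1"
      with assms[of t] show "(?D m has_real_derivative ?D (Suc m) t) (at t)"
        by (cases "m = 0") (auto simp: less_2_cases_iff intro!: log_summand_deriv1 log_summand_deriv2)
    qed
  qed auto
  then show ?thesis by (auto simp: numeral_2_eq_2 intro: that)
qed

section \<open>Critical points\<close>

text \<open>Subtracting the third equation from the first two eliminates both \<open>ln r\<close>
  and the digamma term at n - r - s - t + 1.\<close>

lemma critical_iff:
  "critical n r s t \<longleftrightarrow> r > 0 \<and> s > 0 \<and> t > 0 \<and> r + s + t < real n \<and>
     (real n - r - s - t) / r = ln s + Digamma (r + 1) - Digamma (t + 1) \<and>
     (real n - r - s + 1) / s = ln s + Digamma (s + 1) - Digamma (t + 1) \<and>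
     Digamma (real n - r - s - t + 1) = ln r + Digamma (t + 1)"
  unfolding critical_def by argo

lemma Digamma_ge_minus_1:
  fixes x :: real
  assumes "x \<ge> 0"
  shows "Digamma (x + 1) \<ge> - 1"
proof -
  have "Digamma (x + 1) \<ge> Digamma 1" using assms by (intro Digamma_real_mono) auto
  then show ?thesis using euler_mascheroni_less_13_over_22 by simp
qed

text \<open>The third equation says that u is roughly r t, and the digamma bounds make this precise
  from both sides. If s <= r, then u/r < (u+t+1)/s, so the reduced equations would give a smaller
  digamma value at r + 1 than at s + 1, against monotonicity. The last inequality is the one that
  excludes s of order n.\<close>

lemma critical_bounds:
  assumes "critical n r s t"
  defines "u \<equiv> real n - r - s - t"
  shows "0 < u" "u \<le> r * (t + 1)" "r * t \<le> u + 1" "r < s" "u / r \<le> 2 * ln (real n + 1) + 1"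
    "2 * ln s \<le> (u + t + 1) / s + ln (t + 1)"
proof -
  note crit = assms(1)[unfolded critical_iff, folded u_def]
  have pos: "r > 0" "s > 0" "t > 0" and u: "u > 0" using crit by (auto simp: u_def)
  have e1: "u / r = ln s + Digamma (r + 1) - Digamma (t + 1)"
    and e2: "(u + t + 1) / s = ln s + Digamma (s + 1) - Digamma (t + 1)"
    and e3: "Digamma (u + 1) = ln r + Digamma (t + 1)"
    using crit by (auto simp: u_def)
  show "0 < u" by fact
  have "ln u \<le> ln r + ln (t + 1)"
    using e3 ln_le_Digamma_plus1[OF u] Digamma_le_ln[of "t + 1"] pos by simp
  then have "ln u \<le> ln (r * (t + 1))" using pos by (simp add: ln_mult)
  then show "u \<le> r * (t + 1)" using pos u by simp
  have "ln r + ln t \<le> ln (u + 1)"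
    using e3 Digamma_le_ln[of "u + 1"] ln_le_Digamma_plus1[of t] pos u by simp
  then have "ln (r * t) \<le> ln (u + 1)" using pos by (simp add: ln_mult)
  then show "r * t \<le> u + 1" using pos u by (subst (asm) ln_le_cancel_iff) auto
  show "r < s"
  proof (rule ccontr)
    assume "\<not> r < s"
    then have "u / r \<le> u / s" using pos u by (intro divide_left_mono) auto
    also have "\<dots> < (u + t + 1) / s" using pos by (simp add: divide_strict_right_mono)
    finally have "Digamma (r + 1) < Digamma (s + 1)" using e1 e2 by simp
    moreover have "Digamma (s + 1) \<le> Digamma (r + 1)"
      using \<open>\<not> r < s\<close> pos by (intro Digamma_real_mono) auto
    ultimately show False by simp
  qed
  have "ln s \<le> ln (real n + 1)" "ln (r + 1) \<le> ln (real n + 1)" using pos u by (auto simp: u_def)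
  then show "u / r \<le> 2 * ln (real n + 1) + 1"
    using e1 Digamma_le_ln[of "r + 1"] Digamma_ge_minus_1[of t] pos by linarith
  show "2 * ln s \<le> (u + t + 1) / s + ln (t + 1)"
    using e2 ln_le_Digamma_plus1[of s] Digamma_le_ln[of "t + 1"] pos by linarith
qed

text \<open>Suppose r < 1. Then u <= t + 1, and positivity of u/r gives t <= 2s, so that n <= 5s + 2
  and s >= exp 9. On the other hand 2 ln s <= 6 + ln(3s) <= 8 + ln s, that is, ln s <= 8.\<close>

lemma critical_r_ge_1:
  assumes "critical n r s t" "real n \<ge> 5 * exp 9 + 2"
  shows "r \<ge> 1"
proof (rule ccontr)
  assume "\<not> r \<ge> 1"
  define u where "u = real n - r - s - t"
  note b = critical_bounds[OF assms(1), folded u_def]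
  have pos: "r > 0" "s > 0" "t > 0" and e1: "u / r = ln s + Digamma (r + 1) - Digamma (t + 1)"
    using assms(1)[unfolded critical_iff, folded u_def] by auto
  have "r * (t + 1) \<le> 1 * (t + 1)" using \<open>\<not> r \<ge> 1\<close> pos by (intro mult_right_mono) auto
  then have ut: "u \<le> t + 1" using b by simp
  have "ln t \<le> ln s + ln (r + 1)"
    using e1 b(1) pos Digamma_le_ln[of "r + 1"] ln_le_Digamma_plus1[of t] divide_pos_pos[of u r] by simp
  also have "\<dots> \<le> ln s + ln 2" using \<open>\<not> r \<ge> 1\<close> pos by simp
  finally have "ln t \<le> ln (s * 2)" using pos by (simp add: ln_mult)
  then have ts: "t \<le> 2 * s" using pos by simp
  have "5 * s + 2 \<ge> real n" using ut ts \<open>\<not> r \<ge> 1\<close> by (simp add: u_def)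
  then have s: "s \<ge> exp 9" using assms(2) by simp
  moreover have "exp 9 \<ge> (1::real)" by simp
  ultimately have s1: "s \<ge> 1" by linarith
  have "(u + t + 1) / s \<le> (6 * s) / s" using ut ts s1 by (intro divide_right_mono) auto
  then have "(u + t + 1) / s \<le> 6" using s1 by simp
  moreover have "ln (t + 1) \<le> ln (3 * s)" using ts s1 pos by simp
  moreover have "ln (3 * s) = ln 3 + ln s" using s1 by (simp add: ln_mult)
  moreover have "ln (3::real) \<le> 3 - 1" by (rule ln_le_minus_one) simp
  ultimately have "ln s \<le> 8" using b(6) by simp
  moreover have "ln s \<ge> 9" using s s1 by (simp add: ln_ge_iff)
  ultimately show False by simp
qed

text \<open>An s above \<epsilon> n would violate 2 ln s <= (u+t+1)/s + ln(t+1), whose right side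
  would be O(1) + ln ln n. The bound on t is that for u/r plus 1/r <= 1, which is where r >= 1
  enters.\<close>

lemma critical_estimates:
  assumes "\<epsilon> > 0"
  shows "\<forall>\<^sub>F n in sequentially. \<forall>r s t. critical n r s t \<longrightarrow>
           1 \<le> r \<and> r < s \<and> s \<le> \<epsilon> * real n \<and> t \<le> 2 * ln (real n + 1) + 2"
proof -
  have "\<forall>\<^sub>F n::nat in sequentially. 2 * ln (\<epsilon> * real n) > (real n + 1) / (\<epsilon> * real n) + ln (3 + 2 * ln (real n + 1))"
    using assms by real_asymp
  moreover have "\<forall>\<^sub>F n::nat in sequentially. real n \<ge> 5 * exp 9 + 2" by real_asymp
  ultimately show ?thesis using eventually_gt_at_top[of 0]
  proof eventually_elim
    case (elim n)
    show ?case
    proof safe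
      fix r s t assume c: "critical n r s t"
      define u where "u = real n - r - s - t"
      note b = critical_bounds[OF c, folded u_def]
      have pos: "r > 0" "s > 0" "t > 0" using c by (auto simp: critical_def)
      show r: "1 \<le> r" by (rule critical_r_ge_1[OF c elim(2)])
      show "r < s" by fact
      have "t \<le> (u + 1) / r" using b(3) pos by (simp add: field_simps)
      also have "\<dots> = u / r + 1 / r" by (simp add: add_divide_distrib)
      also have "\<dots> \<le> 2 * ln (real n + 1) + 1 + 1" using b(5) r by (intro add_mono) auto
      finally show t: "t \<le> 2 * ln (real n + 1) + 2" by simp
      show "s \<le> \<epsilon> * real n"
      proof (rule ccontr)
        assume "\<not> s \<le> \<epsilon> * real n"
        moreover have en: "\<epsilon> * real n > 0" using assms elim by simp
        ultimately have "ln s \<ge> ln (\<epsilon> * real n)" by simp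
        moreover have "(u + t + 1) / s \<le> (real n + 1) / (\<epsilon> * real n)"
          using \<open>\<not> s \<le> \<epsilon> * real n\<close> b(1) pos en by (intro frac_le) (auto simp: u_def)
        moreover have "ln (t + 1) \<le> ln (3 + 2 * ln (real n + 1))"
          using t pos by simp
        ultimately show False using elim(1) b(6) by linarith
      qed
    qed
  qed
qed

text \<open>The derivative of ln F at (r, s, t) along (a, b, c): the brackets are the three partial
  derivatives, so at a critical point it vanishes in every direction.\<close>

definition critical_grad :: "real \<Rightarrow> real \<Rightarrow> real \<Rightarrow> real \<Rightarrow> real \<Rightarrow> real \<Rightarrow> real \<Rightarrow> real" where
  "critical_grad N a b c r s t =
     a * (- ln r - ln s + (N - r - s - t) / r - Digamma (r + 1) + Digamma (N - r - s - t + 1)) +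
     b * (- ln r - ln s + (N - r - s + 1) / s - Digamma (s + 1) + Digamma (N - r - s - t + 1)) +
     c * (- ln r - Digamma (t + 1) + Digamma (N - r - s - t + 1))"

text \<open>
  The Hessian of \<open>ln F\<close> is negative definite only where \<open>n - r - s - t\<close> is not too small; the half-space
  below is convex and contains all critical points.
\<close>

lemma critical_grad_deriv_neg:
  assumes pos: "r + x * a > 0" "s + x * b > 0" "t + x * c > 0"
    and half: "2 * ((r + x * a) + (s + x * b) + (t + x * c)) + 1 \<le> N"
    and nz: "\<not> (a = 0 \<and> b = 0 \<and> c = 0)"
  shows "\<exists>D<0. ((\<lambda>x. critical_grad N a b c (r + x * a) (s + x * b) (t + x * c)) has_real_derivative D) (at x)"
proof -
  define R S T u where "R = r + x * a" and "S = s + x * b" and "T = t + x * c"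
    and "u = N - R - S - T"
  have pos': "R > 0" "S > 0" "T > 0" and u: "u \<ge> R + S + T + 1"
    using pos half unfolding R_def[symmetric] S_def[symmetric] T_def[symmetric] by (auto simp: u_def)
  have np: "R + 1 \<notin> \<int>\<^sub>\<le>\<^sub>0" "S + 1 \<notin> \<int>\<^sub>\<le>\<^sub>0" "T + 1 \<notin> \<int>\<^sub>\<le>\<^sub>0" "u + 1 \<notin> \<int>\<^sub>\<le>\<^sub>0"
    using pos' u by (auto intro!: not_nonpos_Ints_pos_real)
  let ?p = "Polygamma 1 (u + 1)"
  define D where "D = a * (- a / R - b / S + (- (a + b + c) * R - u * a) / (R * R)
        - Polygamma 1 (R + 1) * a - ?p * (a + b + c))
      + b * (- a / R - b / S + (- (a + b) * S - (u + T + 1) * b) / (S * S)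
        - Polygamma 1 (S + 1) * b - ?p * (a + b + c))
      + c * (- a / R - Polygamma 1 (T + 1) * c - ?p * (a + b + c))"
  have "((\<lambda>x. critical_grad N a b c (r + x * a) (s + x * b) (t + x * c)) has_real_derivative D) (at x)"
    unfolding critical_grad_def D_def u_def R_def S_def T_def
    by (rule derivative_eq_intros refl np[unfolded u_def R_def S_def T_def] pos
        | use pos in \<open>simp; fail\<close> | simp add: algebra_simps)+
  moreover have "D < 0"
  proof -
    \<comment> \<open>In -D the mixed term 2(R+S)XY costs at most (R+S)(X^2+Y^2), and 2cX costs at
      most c^2/(T+1) + (T+1)X^2, of which the trigamma term at T + 1 covers the first part. The
      demand on u X^2 is therefore R+S+T+1, which is exactly the half-space condition on u.
      Strictness comes from the untouched 2RX^2 + 2SY^2 + (a+b+c)^2 \<open>?p\<close>.\<close>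
    define X Y where "X = a / R" and "Y = b / S"
    have ab: "a = R * X" "b = S * Y" using pos' by (auto simp: X_def Y_def)
    have "(- (a + b + c) * R - u * a) / (R * R) = - (a + b + c) / R - u * X / R"
      "(- (a + b) * S - (u + T + 1) * b) / (S * S) = - (a + b) / S - (u + T + 1) * Y / S"
      using pos' by (simp_all add: X_def Y_def field_simps)
    then have "D = - (2 * a * X + 2 * (a * Y + b * X) + 2 * b * Y + 2 * c * X + u * X\<^sup>2 + (u + T + 1) * Y\<^sup>2
        + a\<^sup>2 * Polygamma 1 (R + 1) + b\<^sup>2 * Polygamma 1 (S + 1) + c\<^sup>2 * Polygamma 1 (T + 1)
        + (a + b + c)\<^sup>2 * ?p)"
      unfolding D_def using pos' by (simp add: X_def Y_def power2_eq_square field_simps)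
    moreover have "2 * a * X + 2 * (a * Y + b * X) + 2 * b * Y = 2 * R * X\<^sup>2 + 2 * (R + S) * (X * Y) + 2 * S * Y\<^sup>2"
      by (simp add: ab power2_eq_square algebra_simps)
    moreover have "2 * (R + S) * (X * Y) \<ge> - (R + S) * (X\<^sup>2 + Y\<^sup>2)"
    proof -
      have "0 \<le> (R + S) * (X + Y)\<^sup>2" using pos' by simp
      then show ?thesis by (simp add: power2_eq_square algebra_simps)
    qed
    moreover have "2 * c * X \<ge> - c\<^sup>2 / (T + 1) - (T + 1) * X\<^sup>2"
    proof -
      have sq: "(c / w + X)\<^sup>2 * w = c\<^sup>2 / w + w * X\<^sup>2 + 2 * c * X" if "w > 0" for w
        using that by (simp add: power2_eq_square field_simps)
      have "0 \<le> (c / (T + 1) + X)\<^sup>2 * (T + 1)" using pos' by simp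
      also have "\<dots> = c\<^sup>2 / (T + 1) + (T + 1) * X\<^sup>2 + 2 * c * X"
        using sq[of "T + 1"] pos' by simp
      finally show ?thesis by simp
    qed
    moreover have "c\<^sup>2 * Polygamma 1 (T + 1) \<ge> c\<^sup>2 / (T + 1)"
      using mult_left_mono[OF Trigamma_ge[of "T + 1"], of "c\<^sup>2"] pos' by simp
    moreover have "a\<^sup>2 * Polygamma 1 (R + 1) \<ge> 0" "b\<^sup>2 * Polygamma 1 (S + 1) \<ge> 0"
      using Polygamma_real_odd_pos[OF np(1), of 1] Polygamma_real_odd_pos[OF np(2), of 1] by auto
    moreover have "(u - (R + S + T + 1)) * X\<^sup>2 \<ge> 0" "(u - (R + S)) * Y\<^sup>2 \<ge> 0" using u pos' by auto
    moreover have "(T + 1) * Y\<^sup>2 \<ge> 0" using pos' by auto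
    moreover have "2 * R * X\<^sup>2 + 2 * S * Y\<^sup>2 + (a + b + c)\<^sup>2 * ?p > 0"
    proof (cases "X = 0 \<and> Y = 0")
      case True
      then have "(a + b + c)\<^sup>2 > 0" using nz ab by simp
      moreover have "?p > 0" using Polygamma_real_odd_pos[OF np(4), of 1] by simp
      ultimately show ?thesis using True by simp
    next
      case False
      have "2 * R * X\<^sup>2 + 2 * S * Y\<^sup>2 > 0"
        using False pos' by (cases "X = 0") (auto intro!: add_pos_nonneg)
      moreover have "(a + b + c)\<^sup>2 * ?p \<ge> 0" using Polygamma_real_odd_pos[OF np(4), of 1] by simp
      ultimately show ?thesis by linarith
    qed
    ultimately show ?thesis by (simp add: algebra_simps)
  qed
  ultimately show ?thesis by blast
qed

text \<open>Along the segment joining two distinct critical points, which stays in the half-space,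
  the derivative of ln F in the direction of the segment decreases strictly, yet it is 0 at both
  ends.\<close>

lemma critical_unique_halfspace:
  assumes c: "critical n r s t" "critical n r' s' t'"
    and half: "2 * (r + s + t) + 1 \<le> real n" "2 * (r' + s' + t') + 1 \<le> real n"
  shows "(r, s, t) = (r', s', t')"
proof (rule ccontr)
  assume ne: "(r, s, t) \<noteq> (r', s', t')"
  define a b d where "a = r' - r" and "b = s' - s" and "d = t' - t"
  let ?g = "\<lambda>x. critical_grad (real n) a b d (r + x * a) (s + x * b) (t + x * d)"
  have D: "\<exists>D<0. (?g has_real_derivative D) (at x)" if "0 \<le> x" "x \<le> 1" for x
  proof (rule critical_grad_deriv_neg)
    have e: "r + x * a = (1 - x) * r + x * r'" "s + x * b = (1 - x) * s + x * s'" "t + x * d = (1 - x) * t + x * t'"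
      by (simp_all add: a_def b_def d_def algebra_simps)
    have pos: "(1 - x) * y + x * y' > 0" if "y > 0" "y' > 0" for y y' :: real
      using \<open>0 \<le> x\<close> \<open>x \<le> 1\<close> that by (cases "x = 0") (auto intro!: add_nonneg_pos mult_nonneg_nonneg)
    show "r + x * a > 0" "s + x * b > 0" "t + x * d > 0"
      unfolding e using c by (auto simp: critical_def intro!: pos)
    have "(1 - x) * (real n - (2 * (r + s + t) + 1)) + x * (real n - (2 * (r' + s' + t') + 1)) \<ge> 0"
      using that half by (intro add_nonneg_nonneg mult_nonneg_nonneg) auto
    then show "2 * ((r + x * a) + (s + x * b) + (t + x * d)) + 1 \<le> real n"
      unfolding e by (simp add: algebra_simps)
    show "\<not> (a = 0 \<and> b = 0 \<and> d = 0)" using ne by (auto simp: a_def b_def d_def)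
  qed
  have "?g 0 > ?g 1"
    by (rule DERIV_neg_imp_decreasing) (use D in auto)
  moreover have "?g 0 = 0" "?g 1 = 0"
    using c by (auto simp: critical_grad_def critical_def a_def b_def d_def)
  ultimately show False by simp
qed

text \<open>The Poincare-Miranda theorem in dimension three, from Brouwer's theorem for the map that
  adds (f, g, h) to the point and clips the result back into the box.\<close>

lemma zero_in_box_3:
  fixes f g h :: "real \<times> real \<times> real \<Rightarrow> real" and l1 u1 l2 u2 l3 u3 :: real
  defines "B \<equiv> {l1..u1} \<times> {l2..u2} \<times> {l3..u3}"
  assumes cont: "continuous_on B f" "continuous_on B g" "continuous_on B h"
    and le: "l1 \<le> u1" "l2 \<le> u2" "l3 \<le> u3"
    and f: "\<And>y z. (l1, y, z) \<in> B \<Longrightarrow> f (l1, y, z) > 0" "\<And>y z. (u1, y, z) \<in> B \<Longrightarrow> f (u1, y, z) < 0"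
    and g: "\<And>x z. (x, l2, z) \<in> B \<Longrightarrow> g (x, l2, z) > 0" "\<And>x z. (x, u2, z) \<in> B \<Longrightarrow> g (x, u2, z) < 0"
    and h: "\<And>x y. (x, y, l3) \<in> B \<Longrightarrow> h (x, y, l3) > 0" "\<And>x y. (x, y, u3) \<in> B \<Longrightarrow> h (x, y, u3) < 0"
  shows "\<exists>x y z. (x, y, z) \<in> B \<and> f (x, y, z) = 0 \<and> g (x, y, z) = 0 \<and> h (x, y, z) = 0"
proof -
  define clip :: "real \<Rightarrow> real \<Rightarrow> real \<Rightarrow> real" where "clip l u v = max l (min u v)" for l u v
  define T where "T p = (clip l1 u1 (fst p + f p), clip l2 u2 (fst (snd p) + g p), clip l3 u3 (snd (snd p) + h p))" for p
  obtain p where "p \<in> B" "T p = p"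
  proof (rule brouwer)
    show "compact B" "convex B" unfolding B_def by (intro compact_Times convex_Times compact_Icc convex_real_interval)+
    show "B \<noteq> {}" unfolding B_def using le by auto
    show "continuous_on B T" unfolding T_def clip_def by (intro continuous_intros cont)
    show "T \<in> B \<rightarrow> B" using le by (auto simp: T_def clip_def B_def)
  qed
  then obtain x y z where B: "(x, y, z) \<in> B" and T: "T (x, y, z) = (x, y, z)" by (cases p) auto
  \<comment> \<open>A fixed coordinate with nonzero displacement must sit on a face with the
    displacement pointing outwards, which the sign conditions forbid.\<close>
  have clip: "v = l \<and> w \<le> 0 \<or> v = u \<and> w \<ge> 0 \<or> w = 0" if "clip l u (v + w) = v" "l \<le> u" for l u v w
    using that by (auto simp: clip_def max_def min_def split: if_splits)
  have "f (x, y, z) = 0" using clip[of l1 u1 x "f (x, y, z)"] le T f[of y z] B by (auto simp: T_def)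
  moreover have "g (x, y, z) = 0" using clip[of l2 u2 y "g (x, y, z)"] le T g[of x z] B by (auto simp: T_def)
  moreover have "h (x, y, z) = 0" using clip[of l3 u3 z "h (x, y, z)"] le T h[of x y] B by (auto simp: T_def)
  ultimately show ?thesis using B by blast
qed

lemma eventually_ex_critical: "\<forall>\<^sub>F n in sequentially. \<exists>r s t. critical n r s t"
proof -
  \<comment> \<open>To leading order the first equation at r = n/(kL) and the second at s = n/(kL)
    have left side (k - 2)L, so k = 4 and k = 1 give opposite signs. The third is about ln(n/(r t)):
    at t = L/4 it is at least about ln 4 because r <= n/L, and at t = L^2 at most about ln(4/L)
    because r >= n/(4L). Here \<open>u\<close> is a lower bound for n - r - s - t on the
    box.\<close>
  have "\<forall>\<^sub>F n::nat in sequentially. let L = ln (real n); u = real n - 2 * (real n / L) - L\<^sup>2 in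
      L > 1 \<and> u > 0 \<and>
      - ln (real n / (4 * L)) - ln (real n / L) + u / (real n / (4 * L)) - ln (real n / (4 * L) + 1) + ln u > 0 \<and>
      - ln (real n / L) - ln (real n / (4 * L)) + (real n + 1) / (real n / L) - ln (real n / L) + ln (real n + 1) < 0 \<and>
      - ln (real n / L) - ln (L / 4 + 1) + ln u > 0 \<and>
      - ln (real n / (4 * L)) - ln (L\<^sup>2) + ln (real n + 1) < 0"
    unfolding Let_def by (intro eventually_conj) real_asymp+
  then show ?thesis
  proof eventually_elim
    case (elim n)
    define N where "N = real n"
    define L where "L = ln N"
    define u0 where "u0 = N - 2 * (N / L) - L\<^sup>2"
    define lo hi where "lo = N / (4 * L)" and "hi = N / L"
    have L: "L > 1" and u0: "u0 > 0"
      and rlo: "- ln lo - ln hi + u0 / lo - ln (lo + 1) + ln u0 > 0"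
      and rhi: "- ln hi - ln lo + (N + 1) / hi - ln hi + ln (N + 1) < 0"
      and tlo: "- ln hi - ln (L / 4 + 1) + ln u0 > 0"
      and thi: "- ln lo - ln (L\<^sup>2) + ln (N + 1) < 0"
      using elim by (simp_all add: Let_def N_def L_def u0_def lo_def hi_def)
    have N: "N > 0" using L by (cases "n = 0") (auto simp: L_def N_def)
    have lo: "lo > 0" "lo \<le> hi" using N L by (auto simp: lo_def hi_def intro!: divide_left_mono)
    let ?B = "{lo..hi} \<times> {lo..hi} \<times> {L/4..L\<^sup>2}"
    have B: "r > 0 \<and> s > 0 \<and> t > 0 \<and> u0 \<le> N - r - s - t \<and> ln lo \<le> ln r \<and> ln r \<le> ln hi \<and>
        ln lo \<le> ln s \<and> ln s \<le> ln hi \<and>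
        ln u0 \<le> Digamma (N - r - s - t + 1) \<and> Digamma (N - r - s - t + 1) \<le> ln (N + 1)"
      if "(r, s, t) \<in> ?B" for r s t
    proof -
      have p: "r > 0" "s > 0" "t > 0" "u0 \<le> N - r - s - t" using that L lo(1) by (auto simp: u0_def hi_def)
      have "ln u0 \<le> ln (N - r - s - t)" using u0 p by simp
      also have "\<dots> \<le> Digamma (N - r - s - t + 1)" using u0 p by (intro ln_le_Digamma_plus1) auto
      finally have 1: "ln u0 \<le> Digamma (N - r - s - t + 1)" .
      have "Digamma (N - r - s - t + 1) \<le> ln (N - r - s - t + 1)" using u0 p by (intro Digamma_le_ln) auto
      also have "\<dots> \<le> ln (N + 1)" using u0 p by simp
      finally show ?thesis using p 1 lo that by auto
    qed
    define f where "f = (\<lambda>(r, s, t). - ln r - ln s + (N - r - s - t) / r - Digamma (r + 1) + Digamma (N - r - s - t + 1))"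
    define g where "g = (\<lambda>(r, s, t). - ln r - ln s + (N - r - s + 1) / s - Digamma (s + 1) + Digamma (N - r - s - t + 1))"
    define h where "h = (\<lambda>(r, s :: real, t). - ln r - Digamma (t + 1) + Digamma (N - r - s - t + 1))"
    have "\<exists>r s t. (r, s, t) \<in> ?B \<and> f (r, s, t) = 0 \<and> g (r, s, t) = 0 \<and> h (r, s, t) = 0"
    proof (rule zero_in_box_3)
      have nz: "fst p \<noteq> 0" "fst (snd p) \<noteq> 0" "fst p + 1 \<notin> \<int>\<^sub>\<le>\<^sub>0" "fst (snd p) + 1 \<notin> \<int>\<^sub>\<le>\<^sub>0"
        "snd (snd p) + 1 \<notin> \<int>\<^sub>\<le>\<^sub>0" "N - fst p - fst (snd p) - snd (snd p) + 1 \<notin> \<int>\<^sub>\<le>\<^sub>0" if "p \<in> ?B" for p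
        using B[of "fst p" "fst (snd p)" "snd (snd p)"] that u0 by (auto intro!: not_nonpos_Ints_pos_real)
      have P: "continuous_on ?B (\<lambda>p. Digamma (k p))" if "continuous_on ?B k" "\<And>p. p \<in> ?B \<Longrightarrow> k p \<notin> \<int>\<^sub>\<le>\<^sub>0"
        for k :: "real \<times> real \<times> real \<Rightarrow> real"
        by (rule continuous_on_compose2[OF continuous_on_Polygamma[of "- \<int>\<^sub>\<le>\<^sub>0"] that(1)]) (use that(2) in auto)
      show "continuous_on ?B f" "continuous_on ?B g" "continuous_on ?B h"
        unfolding f_def g_def h_def case_prod_beta
        by (intro continuous_intros P ballI nz; assumption)+
      show "lo \<le> hi" "lo \<le> hi" using lo by auto
      have "L * 1 \<le> L * L" using L by (intro mult_left_mono) auto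
      then show "L/4 \<le> L\<^sup>2" using L by (simp add: power2_eq_square)
    next
      fix s t assume p: "(lo, s, t) \<in> ?B"
      have "u0 / lo \<le> (N - lo - s - t) / lo" using B[OF p] by (intro divide_right_mono) auto
      moreover have "Digamma (lo + 1) \<le> ln (lo + 1)" using lo by (intro Digamma_le_ln) auto
      ultimately show "f (lo, s, t) > 0" using B[OF p] rlo by (simp add: f_def)
    next
      fix s t assume p: "(hi, s, t) \<in> ?B"
      have "(N - hi - s - t) / hi \<le> (N + 1) / hi" using B[OF p] by (intro divide_right_mono) auto
      moreover have "Digamma (hi + 1) \<ge> ln hi" using lo by (intro ln_le_Digamma_plus1) auto
      ultimately show "f (hi, s, t) < 0" using B[OF p] rhi by (simp add: f_def)
    next
      fix r t assume p: "(r, lo, t) \<in> ?B"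
      have "u0 / lo \<le> (N - r - lo + 1) / lo" using B[OF p] by (intro divide_right_mono) auto
      moreover have "Digamma (lo + 1) \<le> ln (lo + 1)" using lo by (intro Digamma_le_ln) auto
      ultimately show "g (r, lo, t) > 0" using B[OF p] rlo by (simp add: g_def)
    next
      fix r t assume p: "(r, hi, t) \<in> ?B"
      have "(N - r - hi + 1) / hi \<le> (N + 1) / hi" using B[OF p] by (intro divide_right_mono) auto
      moreover have "Digamma (hi + 1) \<ge> ln hi" using lo by (intro ln_le_Digamma_plus1) auto
      ultimately show "g (r, hi, t) < 0" using B[OF p] rhi by (simp add: g_def)
    next
      fix r s assume p: "(r, s, L/4) \<in> ?B"
      have "Digamma (L/4 + 1) \<le> ln (L/4 + 1)" using L by (intro Digamma_le_ln) auto
      then show "h (r, s, L/4) > 0" using B[OF p] tlo by (simp add: h_def)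
    next
      fix r s assume p: "(r, s, L\<^sup>2) \<in> ?B"
      have "Digamma (L\<^sup>2 + 1) \<ge> ln (L\<^sup>2)" using L by (intro ln_le_Digamma_plus1) auto
      then show "h (r, s, L\<^sup>2) < 0" using B[OF p] thi by (simp add: h_def)
    qed
    then obtain r s t where p: "(r, s, t) \<in> ?B" and "f (r, s, t) = 0" "g (r, s, t) = 0" "h (r, s, t) = 0" by blast
    then have "critical n r s t"
      using B[OF p] u0 unfolding critical_def f_def g_def h_def N_def by auto
    then show ?case by blast
  qed
qed

lemma eventually_ex1_critical: "\<forall>\<^sub>F n in sequentially. \<exists>!(r, s, t). critical n r s t"
proof -
  \<comment> \<open>With r < s <= n/16 and t = O(ln n), the half-space condition asks for n/4 + O(ln
    n) <= n.\<close>
  have "\<forall>\<^sub>F n::nat in sequentially. 2 * (2 * (1/16 * real n) + (2 * ln (real n + 1) + 2)) + 1 \<le> real n"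
    by real_asymp
  then show ?thesis
    using critical_estimates[of "1/16", simplified] eventually_ex_critical
  proof eventually_elim
    case (elim n)
    have half: "2 * (r + s + t) + 1 \<le> real n" if "critical n r s t" for r s t
      using elim(2)[rule_format, OF that] elim(1) by simp
    from elim(3) obtain r s t where c: "critical n r s t" by blast
    show ?case
    proof (rule ex1I[of _ "(r, s, t)"])
      show "case (r, s, t) of (r, s, t) \<Rightarrow> critical n r s t" using c by simp
      fix q assume "case q of (r, s, t) \<Rightarrow> critical n r s t"
      then show "q = (r, s, t)"
        using critical_unique_halfspace[OF _ c _ half[OF c]] half by (cases q) auto
    qed
  qed
qed

section \<open>Laplace's method for double sums\<close>

lemma integrable_exp_minus_abs:
  assumes "a > 0"
  shows "integrable lborel (\<lambda>x::real. exp (- a * \<bar>x\<bar>))"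
proof -
  let ?f = "\<lambda>x::real. indicator {0..} x *\<^sub>R exp (- a * x)"
  have "(\<lambda>x::real. exp (- a * x)) absolutely_integrable_on {0..}"
    by (intro nonnegative_absolutely_integrable_1 integrable_on_exp_minus_to_infinity assms) auto
  then have "integrable lebesgue ?f" by (simp add: set_integrable_def)
  then have f: "integrable lborel ?f" by (subst (asm) integrable_completion) auto
  then have "integrable lborel (\<lambda>x. ?f (0 + (- 1) * x))"
    by (rule lborel_integrable_real_affine) simp
  with f have "integrable lborel (\<lambda>x. ?f x + ?f (0 + (- 1) * x))" by (rule Bochner_Integration.integrable_add)
  then show ?thesis
    by (rule Bochner_Integration.integrable_bound) (auto split: split_indicator)
qed

lemma integrable_lborel_pair_mult:
  fixes f g :: "real \<Rightarrow> real"
  assumes "integrable lborel f" "integrable lborel g"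
  shows "integrable (lborel \<Otimes>\<^sub>M lborel) (\<lambda>(x, y). f x * g y)"
proof (rule lborel_pair.Fubini_integrable)
  have [measurable]: "f \<in> borel_measurable borel" "g \<in> borel_measurable borel"
    using assms by auto
  show "(\<lambda>(x, y). f x * g y) \<in> borel_measurable (lborel \<Otimes>\<^sub>M lborel)" by measurable
qed (use assms in \<open>auto simp: abs_mult\<close>)

lemma has_bochner_integral_gaussian: "has_bochner_integral lborel (\<lambda>x::real. exp (- x\<^sup>2 / 2)) (sqrt (2 * pi))"
proof -
  have "has_bochner_integral lborel (\<lambda>x. sqrt (2 * pi) * (std_normal_density x * x ^ (2 * 0))) (sqrt (2 * pi) * 1)"
    using std_normal_moment_even[of 0] by (intro has_bochner_integral_mult_right) simp
  then show ?thesis by (simp add: std_normal_density_def)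
qed

lemma integral_gaussian_2: "integral\<^sup>L (lborel \<Otimes>\<^sub>M lborel) (\<lambda>(x, y). exp (- (x\<^sup>2 + y\<^sup>2) / 2)) = 2 * pi"
proof -
  let ?g = "\<lambda>x::real. exp (- x\<^sup>2 / 2)"
  have g: "integrable lborel ?g" "integral\<^sup>L lborel ?g = sqrt (2 * pi)"
    using has_bochner_integral_gaussian by (auto simp: has_bochner_integral_iff)
  have "integral\<^sup>L (lborel \<Otimes>\<^sub>M lborel) (\<lambda>(x, y). ?g x * ?g y) = (\<integral>x. (\<integral>y. ?g x * ?g y \<partial>lborel) \<partial>lborel)"
    using lborel_pair.integral_fst[OF integrable_lborel_pair_mult[OF g(1) g(1)]] by simp
  also have "\<dots> = 2 * pi" using g(2) by simp
  finally show ?thesis by (simp add: exp_add [symmetric] add_divide_distrib diff_divide_distrib)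
qed

text \<open>
  Concavity along rays turns convergence near the origin into a global exponential bound, so that
  no separate tail estimates are needed.
\<close>

lemma concave_rays_imp_exp_decay:
  fixes f :: "real \<Rightarrow> real \<Rightarrow> real"
  assumes conc: "\<And>x y l. (x, y) \<in> D \<Longrightarrow> 0 \<le> l \<Longrightarrow> l \<le> 1 \<Longrightarrow> l * f x y \<le> f (l * x) (l * y)"
    and near: "\<And>x y. \<bar>x\<bar> \<le> 1 \<Longrightarrow> \<bar>y\<bar> \<le> 1 \<Longrightarrow> \<bar>f x y + (x\<^sup>2 + y\<^sup>2) / 2\<bar> \<le> 1/4"
    and D: "(x, y) \<in> D"
  shows "f x y \<le> 2 - (\<bar>x\<bar> + \<bar>y\<bar>) / 8"
proof -
  define M where "M = max \<bar>x\<bar> \<bar>y\<bar>"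
  have M: "\<bar>x\<bar> \<le> M" "\<bar>y\<bar> \<le> M" "M = \<bar>x\<bar> \<or> M = \<bar>y\<bar>" by (auto simp: M_def)
  show ?thesis
  proof (cases "M \<le> 1")
    case True
    then have "\<bar>f x y + (x\<^sup>2 + y\<^sup>2) / 2\<bar> \<le> 1/4" using M by (intro near) auto
    moreover have "x\<^sup>2 + y\<^sup>2 \<ge> 0" by simp
    ultimately have "f x y \<le> 1/4" unfolding abs_le_iff by argo
    then show ?thesis using True M(1,2) by argo
  next
    case False
    \<comment> \<open>Shrink the point to the boundary of the unit square, where f <= -1/2 + 1/4.
      Concavity along the ray then gives f <= -M/4 at the original point, and M is at least half of
      |x| + |y|.\<close>
    define l where "l = 1 / M"
    have l: "0 \<le> l" "l \<le> 1" "M * l = 1" using False by (auto simp: l_def)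
    have "\<bar>l * x\<bar> = \<bar>x\<bar> / M" "\<bar>l * y\<bar> = \<bar>y\<bar> / M" using False by (auto simp: l_def abs_mult)
    moreover have "\<bar>x\<bar> / M \<le> 1" "\<bar>y\<bar> / M \<le> 1" "\<bar>x\<bar> / M = 1 \<or> \<bar>y\<bar> / M = 1"
      using M False by (auto simp: divide_le_eq)
    ultimately have lx: "\<bar>l * x\<bar> \<le> 1" "\<bar>l * y\<bar> \<le> 1" "\<bar>l * x\<bar> = 1 \<or> \<bar>l * y\<bar> = 1" by auto
    have "(l * x)\<^sup>2 + (l * y)\<^sup>2 \<ge> 1"
    proof -
      have "(l * x)\<^sup>2 = 1 \<or> (l * y)\<^sup>2 = 1" using lx(3) by (metis power2_abs power_one)
      moreover have "(l * x)\<^sup>2 \<ge> 0" "(l * y)\<^sup>2 \<ge> 0" by (rule zero_le_power2)+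
      ultimately show ?thesis by linarith
    qed
    then have "f (l * x) (l * y) \<le> - 1/4" using near[OF lx(1,2)] unfolding abs_le_iff by argo
    then have "l * f x y \<le> - 1/4" using conc[OF D l(1,2)] by linarith
    then have "M * (l * f x y) \<le> M * (- 1/4)" using False by (intro mult_left_mono) auto
    moreover have "M * (l * f x y) = f x y" using l(3) by (simp flip: mult.assoc)
    ultimately show ?thesis using M(1,2) by argo
  qed
qed

text \<open>Half-open cells tile the line, so each x has exactly one index. This makes the step
  function below a single value rather than a sum over cells.\<close>

lemma grid_cell_iff:
  fixes a p x :: real
  assumes "a > 0"
  shows "x \<in> {(real j - p) * a..<(real j - p) * a + a} \<longleftrightarrow> int j = \<lfloor>p + x / a\<rfloor>"
proof -
  have "x \<in> {(real j - p) * a..<(real j - p) * a + a} \<longleftrightarrow> real j \<le> p + x / a \<and> p + x / a < real j + 1"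
    using assms by (auto simp: field_simps)
  also have "\<dots> \<longleftrightarrow> int j = \<lfloor>p + x / a\<rfloor>" by (auto simp: floor_eq_iff eq_commute[of "int j"])
  finally show ?thesis .
qed

lemma floor_grid_close:
  fixes a p x :: real
  assumes "a > 0"
  shows "\<bar>(real_of_int \<lfloor>p + x / a\<rfloor> - p) * a - x\<bar> \<le> a"
proof -
  define d where "d = p + x / a - of_int \<lfloor>p + x / a\<rfloor>"
  have d: "0 \<le> d" "d \<le> 1" unfolding d_def by linarith+
  have "(real_of_int \<lfloor>p + x / a\<rfloor> - p) * a - x = - d * a"
    using assms unfolding d_def by (simp add: algebra_simps)
  then show ?thesis using d assms by (simp add: abs_mult mult_left_le_one_le)
qed

text \<open>The scaled sum is the integral of a step function constant on cells of size \<alpha> by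
  \<beta>, and dominated convergence applies to it. The set \<open>D n\<close> is the rescaled
  domain of the summand; the last hypothesis says that the index range 0..n already catches every
  grid point in it. Ray concavity and closeness to the quadratic on the unit square produce the
  majorant.\<close>

lemma laplace_double_sum:
  fixes f :: "nat \<Rightarrow> real \<Rightarrow> real \<Rightarrow> real" and D :: "nat \<Rightarrow> (real \<times> real) set"
    and \<alpha> \<beta> \<rho> \<sigma> :: "nat \<Rightarrow> real"
  assumes pos: "\<forall>\<^sub>F n in sequentially. \<alpha> n > 0 \<and> \<beta> n > 0"
    and mesh: "\<alpha> \<longlonglongrightarrow> 0" "\<beta> \<longlonglongrightarrow> 0"
    and conc: "\<forall>\<^sub>F n in sequentially. \<forall>x y l. (x, y) \<in> D n \<longrightarrow> 0 \<le> l \<longrightarrow> l \<le> 1 \<longrightarrow> l * f n x y \<le> f n (l * x) (l * y)"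
    and unif: "\<And>K e. K > 0 \<Longrightarrow> e > 0 \<Longrightarrow> \<forall>\<^sub>F n in sequentially. \<forall>x y. \<bar>x\<bar> \<le> K \<longrightarrow> \<bar>y\<bar> \<le> K \<longrightarrow>
                 (x, y) \<in> D n \<and> \<bar>f n x y + (x\<^sup>2 + y\<^sup>2) / 2\<bar> \<le> e"
    and grid: "\<forall>\<^sub>F n in sequentially. \<forall>i j :: int.
                 ((of_int i - \<rho> n) * \<alpha> n, (of_int j - \<sigma> n) * \<beta> n) \<in> D n \<longrightarrow> 0 \<le> i \<and> i \<le> int n \<and> 0 \<le> j \<and> j \<le> int n"
  shows "(\<lambda>n. \<alpha> n * \<beta> n * (\<Sum>i=0..n. \<Sum>j=0..n.
            if ((real i - \<rho> n) * \<alpha> n, (real j - \<sigma> n) * \<beta> n) \<in> D n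
            then exp (f n ((real i - \<rho> n) * \<alpha> n) ((real j - \<sigma> n) * \<beta> n)) else 0)) \<longlonglongrightarrow> 2 * pi"
proof -
  define W where "W n x y = (if (x, y) \<in> D n then exp (f n x y) else 0)" for n x y
  define X where "X n i = (of_int i - \<rho> n) * \<alpha> n" for n and i :: int
  define Y where "Y n j = (of_int j - \<sigma> n) * \<beta> n" for n and j :: int
  define h where "h n = (\<lambda>(x, y). \<Sum>i=0..n. \<Sum>j=0..n. W n (X n (int i)) (Y n (int j)) *
      indicator ({X n (int i)..<X n (int i) + \<alpha> n} \<times> {Y n (int j)..<Y n (int j) + \<beta> n}) (x, y))" for n
  have int_h: "has_bochner_integral (lborel \<Otimes>\<^sub>M lborel) (h n)
      (\<Sum>i=0..n. \<Sum>j=0..n. W n (X n (int i)) (Y n (int j)) * (\<alpha> n * \<beta> n))" if "\<alpha> n > 0" "\<beta> n > 0" for n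
    unfolding h_def case_prod_beta prod.collapse
  proof (intro has_bochner_integral_sum has_bochner_integral_mult_right)
    fix i j
    have em: "emeasure (lborel \<Otimes>\<^sub>M lborel) ({X n (int i)..<X n (int i) + \<alpha> n} \<times> {Y n (int j)..<Y n (int j) + \<beta> n})
        = ennreal (\<alpha> n * \<beta> n)"
      using that by (subst lborel.emeasure_pair_measure_Times) (auto simp: ennreal_mult)
    then have "has_bochner_integral (lborel \<Otimes>\<^sub>M lborel)
        (indicator ({X n (int i)..<X n (int i) + \<alpha> n} \<times> {Y n (int j)..<Y n (int j) + \<beta> n}))
        (measure (lborel \<Otimes>\<^sub>M lborel) ({X n (int i)..<X n (int i) + \<alpha> n} \<times> {Y n (int j)..<Y n (int j) + \<beta> n}))"
      by (intro has_bochner_integral_real_indicator) auto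
    then show "has_bochner_integral (lborel \<Otimes>\<^sub>M lborel)
        (indicator ({X n (int i)..<X n (int i) + \<alpha> n} \<times> {Y n (int j)..<Y n (int j) + \<beta> n})) (\<alpha> n * \<beta> n)"
      using em that by (simp add: measure_def)
  qed
  \<comment> \<open>The value at the lower left corner of the cell containing (x, y). If that cell
    has an index outside 0..n, no summand reaches (x, y), and the corner lies outside
    \<open>D n\<close>, so both sides are 0.\<close>
  have h_eq: "h n (x, y) = W n (X n \<lfloor>\<rho> n + x / \<alpha> n\<rfloor>) (Y n \<lfloor>\<sigma> n + y / \<beta> n\<rfloor>)"
    if pos: "\<alpha> n > 0" "\<beta> n > 0" and g: "\<forall>i j :: int. (X n i, Y n j) \<in> D n \<longrightarrow> 0 \<le> i \<and> i \<le> int n \<and> 0 \<le> j \<and> j \<le> int n"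
    for n x y
  proof -
    define I J where "I = \<lfloor>\<rho> n + x / \<alpha> n\<rfloor>" and "J = \<lfloor>\<sigma> n + y / \<beta> n\<rfloor>"
    have cell: "indicator ({X n (int i)..<X n (int i) + \<alpha> n} \<times> {Y n (int j)..<Y n (int j) + \<beta> n}) (x, y)
        = (if int j = J then if int i = I then 1 else 0 else (0::real))" for i j
      using grid_cell_iff[OF pos(1), of x i "\<rho> n"] grid_cell_iff[OF pos(2), of y j "\<sigma> n"]
      by (auto simp: I_def J_def X_def Y_def indicator_def)
    show ?thesis
    proof (cases "0 \<le> I \<and> I \<le> int n \<and> 0 \<le> J \<and> J \<le> int n")
      case True
      then obtain i j where ij: "I = int i" "J = int j" "i \<in> {0..n}" "j \<in> {0..n}"
        by (metis atLeastAtMost_iff le0 nonneg_int_cases of_nat_le_iff)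
      have "h n (x, y) = (\<Sum>i'=0..n. \<Sum>j'=0..n. if j' = j then (if i' = i then W n (X n (int i')) (Y n (int j')) else 0) else 0)"
        unfolding h_def case_prod_conv cell ij(1,2) by (intro sum.cong refl) auto
      also have "\<dots> = W n (X n (int i)) (Y n (int j))" using ij(3,4) by (simp add: sum.delta)
      finally show ?thesis using ij by (simp add: I_def J_def)
    next
      case False
      then have "W n (X n I) (Y n J) = 0" using g by (auto simp: W_def)
      moreover have "h n (x, y) = 0"
        unfolding h_def case_prod_conv cell using False by (intro sum.neutral ballI) auto
      ultimately show ?thesis by (simp add: I_def J_def)
    qed
  qed
  have grid': "\<forall>\<^sub>F n in sequentially. \<forall>i j :: int. (X n i, Y n j) \<in> D n \<longrightarrow> 0 \<le> i \<and> i \<le> int n \<and> 0 \<le> j \<and> j \<le> int n"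
    using grid by (simp add: X_def Y_def)
  have small: "\<forall>\<^sub>F n in sequentially. \<alpha> n < 1" "\<forall>\<^sub>F n in sequentially. \<beta> n < 1"
    using mesh by (auto intro: order_tendstoD)
  \<comment> \<open>The decay bound has exponent 2 at the corner of the cell; moving from the corner
    to (x, y) costs at most (\<alpha> + \<beta>)/8 < 1, and 3 leaves room for it.\<close>
  let ?w = "\<lambda>(x :: real, y :: real). exp 3 * exp (- (1/8) * \<bar>x\<bar>) * exp (- (1/8) * \<bar>y\<bar>)"
  have "\<forall>\<^sub>F n in sequentially. (\<alpha> n > 0 \<and> \<beta> n > 0) \<and> (\<forall>x y. \<bar>h n (x, y)\<bar> \<le> ?w (x, y))"
    using pos grid' small conc unif[of 1 "1/4", simplified]
  proof eventually_elim
    case (elim n)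
    have "\<bar>h n (x, y)\<bar> \<le> ?w (x, y)" for x y
    proof -
      define x' y' where "x' = X n \<lfloor>\<rho> n + x / \<alpha> n\<rfloor>" and "y' = Y n \<lfloor>\<sigma> n + y / \<beta> n\<rfloor>"
      have c: "\<bar>x' - x\<bar> \<le> \<alpha> n" "\<bar>y' - y\<bar> \<le> \<beta> n"
        unfolding x'_def y'_def X_def Y_def using elim by (auto intro!: floor_grid_close)
      have "h n (x, y) = W n x' y'" unfolding x'_def y'_def using elim by (intro h_eq) auto
      moreover have "\<bar>W n x' y'\<bar> \<le> exp (3 - (\<bar>x\<bar> + \<bar>y\<bar>) / 8)"
      proof (cases "(x', y') \<in> D n")
        case True
        have "f n x' y' \<le> 2 - (\<bar>x'\<bar> + \<bar>y'\<bar>) / 8"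
          by (rule concave_rays_imp_exp_decay[OF _ _ True]) (use elim in auto)
        also have "\<dots> \<le> 3 - (\<bar>x\<bar> + \<bar>y\<bar>) / 8" using c elim(3,4) by argo
        finally show ?thesis using True by (simp add: W_def)
      qed (simp add: W_def)
      ultimately show ?thesis by (simp add: exp_add [symmetric] algebra_simps add_divide_distrib)
    qed
    then show ?case using elim by auto
  qed
  then obtain N where N: "\<And>n. n \<ge> N \<Longrightarrow> \<alpha> n > 0 \<and> \<beta> n > 0" "\<And>n x y. n \<ge> N \<Longrightarrow> \<bar>h n (x, y)\<bar> \<le> ?w (x, y)"
    unfolding eventually_sequentially by blast
  have lim: "(\<lambda>n. h n (x, y)) \<longlonglongrightarrow> exp (- (x\<^sup>2 + y\<^sup>2) / 2)" for x y
  proof -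
    define x' y' where "x' n = X n \<lfloor>\<rho> n + x / \<alpha> n\<rfloor>" and "y' n = Y n \<lfloor>\<sigma> n + y / \<beta> n\<rfloor>" for n
    define K where "K = \<bar>x\<bar> + \<bar>y\<bar> + 1"
    have c: "\<forall>\<^sub>F n in sequentially. \<bar>x' n - x\<bar> \<le> \<alpha> n \<and> \<bar>y' n - y\<bar> \<le> \<beta> n"
      using pos by eventually_elim (auto simp: x'_def y'_def X_def Y_def intro!: floor_grid_close)
    have "(\<lambda>n. x' n - x) \<longlonglongrightarrow> 0" "(\<lambda>n. y' n - y) \<longlonglongrightarrow> 0"
      by (rule Lim_null_comparison[OF _ mesh(1)], use c in \<open>eventually_elim, simp\<close>)
         (rule Lim_null_comparison[OF _ mesh(2)], use c in \<open>eventually_elim, simp\<close>)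
    then have x': "x' \<longlonglongrightarrow> x" and y': "y' \<longlonglongrightarrow> y" by (auto simp: LIM_zero_iff)
    have bd: "\<forall>\<^sub>F n in sequentially. \<bar>x' n\<bar> \<le> K \<and> \<bar>y' n\<bar> \<le> K"
      using c small by eventually_elim (auto simp: K_def)
    have K: "K > 0" by (simp add: K_def)
    have "(\<lambda>n. f n (x' n) (y' n) + ((x' n)\<^sup>2 + (y' n)\<^sup>2) / 2) \<longlonglongrightarrow> 0"
    proof (rule tendstoI)
      fix e :: real assume "e > 0"
      show "\<forall>\<^sub>F n in sequentially. dist (f n (x' n) (y' n) + ((x' n)\<^sup>2 + (y' n)\<^sup>2) / 2) 0 < e"
        using unif[OF K half_gt_zero[OF \<open>e > 0\<close>]] bd
      proof eventually_elim
        case (elim n)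
        then have "\<bar>f n (x' n) (y' n) + ((x' n)\<^sup>2 + (y' n)\<^sup>2) / 2\<bar> \<le> e / 2" by blast
        also have "\<dots> < e" using \<open>e > 0\<close> by simp
        finally show ?case by (simp add: dist_real_def)
      qed
    qed
    moreover have "(\<lambda>n. ((x' n)\<^sup>2 + (y' n)\<^sup>2) / 2) \<longlonglongrightarrow> (x\<^sup>2 + y\<^sup>2) / 2" by (intro tendsto_intros x' y') simp
    ultimately have "(\<lambda>n. (f n (x' n) (y' n) + ((x' n)\<^sup>2 + (y' n)\<^sup>2) / 2) - ((x' n)\<^sup>2 + (y' n)\<^sup>2) / 2)
        \<longlonglongrightarrow> 0 - (x\<^sup>2 + y\<^sup>2) / 2" by (rule tendsto_diff)
    moreover have "0 - (x\<^sup>2 + y\<^sup>2) / 2 = - (x\<^sup>2 + y\<^sup>2) / 2" by argo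
    ultimately have "(\<lambda>n. exp (f n (x' n) (y' n))) \<longlonglongrightarrow> exp (- (x\<^sup>2 + y\<^sup>2) / 2)"
      by (intro tendsto_exp) (simp only: add_diff_cancel_right')
    moreover have "\<forall>\<^sub>F n in sequentially. exp (f n (x' n) (y' n)) = h n (x, y)"
      using unif[OF K, of 1, simplified] bd pos grid'
    proof eventually_elim
      case (elim n)
      have "h n (x, y) = W n (x' n) (y' n)" unfolding x'_def y'_def using elim by (intro h_eq) auto
      then show ?case using elim by (auto simp: W_def)
    qed
    ultimately show ?thesis by (rule Lim_transform_eventually)
  qed
  \<comment> \<open>The shift by \<open>N\<close> is made because measurability and domination are
    known only from \<open>N\<close> on, while the convergence theorem asks for them at every
    index.\<close>
  have "(\<lambda>n. integral\<^sup>L (lborel \<Otimes>\<^sub>M lborel) (h (n + N))) \<longlonglongrightarrow>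
      integral\<^sup>L (lborel \<Otimes>\<^sub>M lborel) (\<lambda>(x, y). exp (- (x\<^sup>2 + y\<^sup>2) / 2))"
  proof (rule integral_dominated_convergence[where w = ?w])
    show "integrable (lborel \<Otimes>\<^sub>M lborel) ?w"
      by (intro integrable_lborel_pair_mult integrable_mult_right integrable_exp_minus_abs) simp_all
    show "(\<lambda>(x, y). exp (- (x\<^sup>2 + y\<^sup>2) / 2)) \<in> borel_measurable (lborel \<Otimes>\<^sub>M (lborel :: real measure))"
      by measurable
    show "h (n + N) \<in> borel_measurable (lborel \<Otimes>\<^sub>M lborel)" for n
      using int_h[of "n + N"] N(1)[of "n + N"] by (auto dest: borel_measurable_has_bochner_integral)
    show "AE p in lborel \<Otimes>\<^sub>M lborel. (\<lambda>n. h (n + N) p) \<longlonglongrightarrow> (case p of (x, y) \<Rightarrow> exp (- (x\<^sup>2 + y\<^sup>2) / 2))"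
      using lim by (auto intro!: AE_I2 LIMSEQ_ignore_initial_segment)
    show "AE p in lborel \<Otimes>\<^sub>M lborel. norm (h (n + N) p) \<le> ?w p" for n
      using N(2)[of "n + N"] by (auto intro!: AE_I2)
  qed
  then have "(\<lambda>n. integral\<^sup>L (lborel \<Otimes>\<^sub>M lborel) (h n)) \<longlonglongrightarrow> 2 * pi"
    unfolding integral_gaussian_2 by (rule LIMSEQ_offset)
  moreover have "\<forall>\<^sub>F n in sequentially. integral\<^sup>L (lborel \<Otimes>\<^sub>M lborel) (h n) =
      \<alpha> n * \<beta> n * (\<Sum>i=0..n. \<Sum>j=0..n. W n (X n (int i)) (Y n (int j)))"
    using pos
  proof eventually_elim
    case (elim n)
    then show ?case
      using int_h[of n] by (simp add: has_bochner_integral_iff sum_distrib_left mult_ac)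
  qed
  ultimately have "(\<lambda>n. \<alpha> n * \<beta> n * (\<Sum>i=0..n. \<Sum>j=0..n. W n (X n (int i)) (Y n (int j)))) \<longlonglongrightarrow> 2 * pi"
    by (rule Lim_transform_eventually)
  then show ?thesis by (simp add: W_def X_def Y_def)
qed

section \<open>Asymptotics at the critical points\<close>

lemma tendsto_mult_bounded_null:
  fixes x c :: "nat \<Rightarrow> real"
  assumes "\<And>n. \<bar>x n\<bar> \<le> K" "c \<longlonglongrightarrow> 0"
  shows "(\<lambda>n. x n * c n) \<longlonglongrightarrow> 0"
proof (rule Lim_null_comparison)
  show "\<forall>\<^sub>F n in sequentially. norm (x n * c n) \<le> K * \<bar>c n\<bar>"
    using assms(1) by (intro always_eventually) (auto simp: abs_mult intro!: mult_right_mono)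
  show "(\<lambda>n. K * \<bar>c n\<bar>) \<longlonglongrightarrow> 0" using assms(2) by (intro tendsto_mult_right_zero tendsto_rabs_zero)
qed

text \<open>For each n choose a point of the square where P fails, if there is one; eventual truth
  along this worst sequence is uniform truth. Limits may then be computed along arbitrary bounded
  sequences.\<close>

lemma eventually_uniform_from_sequences:
  fixes P :: "nat \<Rightarrow> real \<Rightarrow> real \<Rightarrow> bool"
  assumes K: "K \<ge> 0"
    and "\<And>x y. (\<And>n. \<bar>x n\<bar> \<le> K) \<Longrightarrow> (\<And>n. \<bar>y n\<bar> \<le> K) \<Longrightarrow> \<forall>\<^sub>F n in sequentially. P n (x n) (y n)"
  shows "\<forall>\<^sub>F n in sequentially. \<forall>x y. \<bar>x\<bar> \<le> K \<longrightarrow> \<bar>y\<bar> \<le> K \<longrightarrow> P n x y"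
proof -
  have "\<forall>n. \<exists>p. \<bar>fst p\<bar> \<le> K \<and> \<bar>snd p\<bar> \<le> K \<and>
      (P n (fst p) (snd p) \<longrightarrow> (\<forall>x y. \<bar>x\<bar> \<le> K \<longrightarrow> \<bar>y\<bar> \<le> K \<longrightarrow> P n x y))"
  proof
    fix n
    show "\<exists>p. \<bar>fst p\<bar> \<le> K \<and> \<bar>snd p\<bar> \<le> K \<and>
      (P n (fst p) (snd p) \<longrightarrow> (\<forall>x y. \<bar>x\<bar> \<le> K \<longrightarrow> \<bar>y\<bar> \<le> K \<longrightarrow> P n x y))"
    proof (cases "\<forall>x y. \<bar>x\<bar> \<le> K \<longrightarrow> \<bar>y\<bar> \<le> K \<longrightarrow> P n x y")
      case True
      then show ?thesis using K by (intro exI[of _ "(0, 0)"]) auto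
    next
      case False
      then obtain x y where "\<bar>x\<bar> \<le> K" "\<bar>y\<bar> \<le> K" "\<not> P n x y" by blast
      then show ?thesis by (intro exI[of _ "(x, y)"]) simp
    qed
  qed
  from choice[OF this] obtain p where p: "\<And>n. \<bar>fst (p n)\<bar> \<le> K" "\<And>n. \<bar>snd (p n)\<bar> \<le> K"
    "\<And>n. P n (fst (p n)) (snd (p n)) \<Longrightarrow> \<forall>x y. \<bar>x\<bar> \<le> K \<longrightarrow> \<bar>y\<bar> \<le> K \<longrightarrow> P n x y" by blast
  have "\<forall>\<^sub>F n in sequentially. P n (fst (p n)) (snd (p n))" by (intro assms p)
  then show ?thesis by eventually_elim (rule p(3))
qed

text \<open>E is t + u times the relative entropy of the distribution (t, u)/(t+u) with respect to
  (1, r)/(1+r). The bounds 1 - 1/x <= ln x <= x - 1 give its nonnegativity and its chi-square upper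
  bound.\<close>

lemma binomial_entropy_bounds:
  fixes t u r :: real
  assumes "t > 0" "u > 0" "r > 0"
  defines "E \<equiv> t * ln t + u * ln u - (t + u) * ln (t + u) + (t + u) * ln (1 + r) - u * ln r"
  shows "0 \<le> E" "E \<le> (t * r - u)\<^sup>2 / ((t + u) * r)"
proof -
  define m where "m = t + u"
  have m: "m > 0" "t + u = m" using assms by (auto simp: m_def)
  define p q where "p = t * (1 + r) / m" and "q = u * (1 + r) / (m * r)"
  have pq: "p > 0" "q > 0" using assms m by (auto simp: p_def q_def)
  have E: "E = t * ln p + u * ln q"
  proof -
    have l: "ln p = ln t + ln (1 + r) - ln m" "ln q = ln u + ln (1 + r) - ln m - ln r"
      using assms(1-3) m(1) by (simp_all add: p_def q_def ln_mult ln_div)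
    show ?thesis unfolding E_def m(2) l by (simp add: m_def algebra_simps)
  qed
  have ln_ge: "1 - 1 / x \<le> ln x" if "x > 0" for x :: real
    using ln_le_minus_one[of "1 / x"] that by (simp add: ln_div)
  have "t * (1 - 1 / p) = t - m / (1 + r)" "u * (1 - 1 / q) = u - m * r / (1 + r)"
    using assms(1-3) m(1) by (simp_all add: p_def q_def right_diff_distrib)
  moreover have "m / (1 + r) + m * r / (1 + r) = m"
    using assms(3) by (simp add: add_divide_distrib [symmetric]) (simp add: field_simps)
  ultimately have "t * (1 - 1 / p) + u * (1 - 1 / q) = 0" using m(2) by linarith
  moreover have "t * (1 - 1 / p) \<le> t * ln p" "u * (1 - 1 / q) \<le> u * ln q"
    using assms pq ln_ge by (auto intro!: mult_left_mono)
  ultimately show "0 \<le> E" unfolding E by linarith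
  have "t * ln p \<le> t * (p - 1)" "u * ln q \<le> u * (q - 1)"
    using assms pq by (auto intro!: mult_left_mono ln_le_minus_one)
  moreover have "t * (p - 1) + u * (q - 1) = (t * r - u)\<^sup>2 / (m * r)"
  proof -
    define d where "d = t * r - u"
    have "p - 1 = d / m" using m(1) by (simp add: p_def d_def field_simps) (simp add: m_def)
    moreover have "q - 1 = - d / (m * r)"
      using m(1) assms(3) by (simp add: q_def d_def field_simps) (simp add: m_def algebra_simps)
    ultimately have "t * (p - 1) + u * (q - 1) = (t * r - u) * d / (m * r)"
      using m(1) assms(3) by (simp add: diff_divide_distrib left_diff_distrib)
    then show ?thesis by (simp add: d_def power2_eq_square)
  qed
  ultimately show "E \<le> (t * r - u)\<^sup>2 / ((t + u) * r)" unfolding E m(2) by linarith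
qed

text \<open>Treats an arbitrary sequence that is critical from some index on, matching the
  quantifier over sequences in the theorem.\<close>

locale critical_sequence =
  fixes r s t :: "nat \<Rightarrow> real"
  assumes crit: "\<forall>\<^sub>F n in sequentially. critical n (r n) (s n) (t n)"
begin

text \<open>\<open>u\<close> is the exponent of r in F; \<open>m\<close> is the exponent of 1 + r
  once t has been summed out.\<close>

definition u :: "nat \<Rightarrow> real" where "u n = real n - r n - s n - t n"
definition m :: "nat \<Rightarrow> real" where "m n = real n - r n - s n"

lemma m_eq: "m n = u n + t n" by (simp add: m_def u_def)

section \<open>Orders of magnitude along a critical sequence\<close>

lemma ev_basic:
  "\<forall>\<^sub>F n in sequentially. critical n (r n) (s n) (t n) \<and> 0 < real n \<and> 1 \<le> r n \<and> r n < s n \<and> 0 < t n \<and> 0 < u n \<and>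
     u n \<le> r n * (t n + 1) \<and> r n * t n \<le> u n + 1"
  using crit critical_estimates[OF zero_less_one] eventually_gt_at_top[of 0]
proof eventually_elim
  case (elim n)
  have "0 < t n" using elim(1) by (simp add: critical_def)
  moreover have "1 \<le> r n" "r n < s n" using elim(1,2) by blast+
  ultimately show ?case using elim(1,3) critical_bounds(1-3)[OF elim(1)] by (simp add: u_def)
qed

lemma s_over_n: "(\<lambda>n. s n / real n) \<longlonglongrightarrow> 0"
proof (rule tendstoI)
  fix e :: real assume "e > 0"
  then have "e / 2 > 0" by simp
  show "\<forall>\<^sub>F n in sequentially. dist (s n / real n) 0 < e"
    using crit critical_estimates[OF \<open>e / 2 > 0\<close>] ev_basic
  proof eventually_elim
    case (elim n)
    then have "s n \<le> e / 2 * real n" by blast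
    then have "s n / real n \<le> e / 2" using elim by (simp add: field_simps)
    moreover have "\<bar>s n / real n\<bar> = s n / real n" using elim by auto
    moreover have "e / 2 < e" using \<open>e > 0\<close> by simp
    ultimately show ?case unfolding dist_real_def diff_0_right by linarith
  qed
qed

lemma r_over_n: "(\<lambda>n. r n / real n) \<longlonglongrightarrow> 0"
proof (rule Lim_null_comparison[OF _ s_over_n])
  show "\<forall>\<^sub>F n in sequentially. norm (r n / real n) \<le> s n / real n"
    using ev_basic by eventually_elim (auto intro!: divide_right_mono)
qed

lemma t_over_n: "(\<lambda>n. t n / real n) \<longlonglongrightarrow> 0"
proof (rule Lim_null_comparison)
  show "\<forall>\<^sub>F n in sequentially. norm (t n / real n) \<le> (2 * ln (real n + 1) + 2) / real n"
    using ev_basic critical_estimates[OF zero_less_one]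
  proof eventually_elim
    case (elim n)
    then have "t n \<le> 2 * ln (real n + 1) + 2" "0 < t n" by blast+
    then show ?case by (simp add: divide_right_mono)
  qed
  show "(\<lambda>n::nat. (2 * ln (real n + 1) + 2) / real n) \<longlonglongrightarrow> 0" by real_asymp
qed

lemma m_over_n: "(\<lambda>n. m n / real n) \<longlonglongrightarrow> 1"
proof (rule Lim_transform_eventually)
  show "(\<lambda>n. 1 - r n / real n - s n / real n) \<longlonglongrightarrow> 1"
    using tendsto_diff[OF tendsto_diff[OF tendsto_const[of 1] r_over_n] s_over_n] by simp
  show "\<forall>\<^sub>F n in sequentially. 1 - r n / real n - s n / real n = m n / real n"
    using ev_basic by eventually_elim (auto simp: m_def diff_divide_distrib)
qed

lemma u_over_n: "(\<lambda>n. u n / real n) \<longlonglongrightarrow> 1"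
proof -
  have "(\<lambda>n. m n / real n - t n / real n) \<longlonglongrightarrow> 1"
    using tendsto_diff[OF m_over_n t_over_n] by simp
  then show ?thesis by (simp add: m_eq add_divide_distrib)
qed

text \<open>Since u is asymptotic to n and u/r = O(ln n), the ratio is O(ln n / sqrt n). It is the
  mesh width in the rescaled r-coordinate.\<close>

lemma sqrt_over_r: "(\<lambda>n. sqrt (real n) / r n) \<longlonglongrightarrow> 0"
proof (rule Lim_null_comparison)
  let ?c = "\<lambda>n::nat. (2 * ln (real n + 1) + 1) / sqrt (real n)"
  show "\<forall>\<^sub>F n in sequentially. norm (sqrt (real n) / r n) \<le> ?c n * (1 / (u n / real n))"
    using ev_basic
  proof eventually_elim
    case (elim n)
    have "u n / r n \<le> 2 * ln (real n + 1) + 1"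
      using critical_bounds(5)[of n "r n" "s n" "t n"] elim by (auto simp: u_def)
    then have "1 / r n \<le> (2 * ln (real n + 1) + 1) / u n" using elim by (simp add: field_simps)
    then have "sqrt (real n) * (1 / r n) \<le> sqrt (real n) * ((2 * ln (real n + 1) + 1) / u n)"
      by (rule mult_left_mono) simp
    also have "\<dots> = ?c n * (1 / (u n / real n))"
    proof -
      have "q * (L / U) = L / q * (1 / (U / (q * q)))" if "q > 0" for q L U :: real
        using that by simp
      from this[of "sqrt (real n)"] show ?thesis using elim by simp
    qed
    finally show ?case using elim by auto
  qed
  have "?c \<longlonglongrightarrow> 0" by real_asymp
  then show "(\<lambda>n. ?c n * (1 / (u n / real n))) \<longlonglongrightarrow> 0"
    using tendsto_mult[OF _ tendsto_divide[OF tendsto_const[of 1] u_over_n], of ?c 0] by simp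
qed

lemma sqrt_over_s: "(\<lambda>n. sqrt (real n) / s n) \<longlonglongrightarrow> 0"
proof (rule Lim_null_comparison[OF _ sqrt_over_r])
  show "\<forall>\<^sub>F n in sequentially. norm (sqrt (real n) / s n) \<le> sqrt (real n) / r n"
    using ev_basic by eventually_elim (auto intro!: divide_left_mono)
qed

lemma over_sqrt: "(\<lambda>n::nat. c / sqrt (real n)) \<longlonglongrightarrow> 0"
  by real_asymp

lemma inverse_r: "(\<lambda>n. 1 / r n) \<longlonglongrightarrow> 0"
proof (rule Lim_null_comparison[OF _ sqrt_over_r])
  show "\<forall>\<^sub>F n in sequentially. norm (1 / r n) \<le> sqrt (real n) / r n"
    using ev_basic by eventually_elim (auto intro!: divide_right_mono)
qed

lemma m_at_top: "filterlim m at_top sequentially"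
proof -
  have "filterlim (\<lambda>n. m n / real n * real n) at_top sequentially"
    by (rule filterlim_tendsto_pos_mult_at_top[OF m_over_n _ filterlim_real_sequentially]) simp
  moreover have "\<forall>\<^sub>F n in sequentially. m n / real n * real n = m n"
    using ev_basic by eventually_elim simp
  ultimately show ?thesis using filterlim_cong by fast
qed

lemma u_at_top: "filterlim u at_top sequentially"
proof -
  have "filterlim (\<lambda>n. u n / real n * real n) at_top sequentially"
    by (rule filterlim_tendsto_pos_mult_at_top[OF u_over_n _ filterlim_real_sequentially]) simp
  moreover have "\<forall>\<^sub>F n in sequentially. u n / real n * real n = u n"
    using ev_basic by eventually_elim simp
  ultimately show ?thesis using filterlim_cong by fast
qed

text \<open>From u <= r (t + 1) one gets t >= u/r - 1, and u/r tends to infinity. This is what makes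
  Stirling's formula applicable at t.\<close>

lemma t_at_top: "filterlim t at_top sequentially"
proof -
  have "filterlim (\<lambda>n. inverse (r n / real n)) at_top sequentially"
    by (rule filterlim_inverse_at_top[OF r_over_n], use ev_basic in eventually_elim) simp
  then have "filterlim (\<lambda>n. u n / real n * inverse (r n / real n)) at_top sequentially"
    by (rule filterlim_tendsto_pos_mult_at_top[OF u_over_n zero_less_one])
  then have "filterlim (\<lambda>n. - 1 + u n / real n * inverse (r n / real n)) at_top sequentially"
    by (rule filterlim_tendsto_add_at_top[OF tendsto_const])
  then show ?thesis
  proof (rule filterlim_at_top_mono)
    show "\<forall>\<^sub>F n in sequentially. - 1 + u n / real n * inverse (r n / real n) \<le> t n"
      using ev_basic by eventually_elim (auto simp: field_simps)
  qed
qed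

lemma ev_r_plus_s_le_m: "\<forall>\<^sub>F n in sequentially. r n + s n \<le> m n"
proof -
  have "(\<lambda>n. m n / real n - r n / real n - s n / real n) \<longlonglongrightarrow> 1"
    using tendsto_diff[OF tendsto_diff[OF m_over_n r_over_n] s_over_n] by simp
  then have "\<forall>\<^sub>F n in sequentially. m n / real n - r n / real n - s n / real n > 0"
    by (rule order_tendstoD) simp
  then show ?thesis using ev_basic
    by eventually_elim (auto simp flip: diff_divide_distrib simp: zero_less_divide_iff)
qed

lemma ev_r_le_u: "\<forall>\<^sub>F n in sequentially. r n \<le> u n"
proof -
  have "(\<lambda>n. u n / real n - r n / real n) \<longlonglongrightarrow> 1"
    using tendsto_diff[OF u_over_n r_over_n] by simp
  then have "\<forall>\<^sub>F n in sequentially. u n / real n - r n / real n > 0"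
    by (rule order_tendstoD) simp
  then show ?thesis using ev_basic
    by eventually_elim (auto simp flip: diff_divide_distrib simp: zero_less_divide_iff)
qed

text \<open>The system is the stationarity of ln F. Passing to the log-summand replaces ln r by
  ln(1+r), u/r by m/(1+r), and the digamma value at u + 1 by that at m + 1. The three discrepancies
  are at most 1/r, 1/r and 3/r.\<close>

lemma ev_gradient_bound:
  "\<forall>\<^sub>F n in sequentially. \<forall>a b. \<bar>log_summand_d1 (real n) a b (r n) (s n)\<bar> \<le> (\<bar>a\<bar> + \<bar>b\<bar>) * (5 / r n)"
  using ev_basic ev_r_le_u
proof eventually_elim
  case (elim n)
  let ?r = "r n" and ?s = "s n" and ?t = "t n" and ?u = "u n" and ?m = "m n"
  have c: "?u / ?r = ln ?s + Digamma (?r + 1) - Digamma (?t + 1)"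
    "(?m + 1) / ?s = ln ?s + Digamma (?s + 1) - Digamma (?t + 1)"
    "Digamma (?u + 1) = ln ?r + Digamma (?t + 1)"
    using elim by (auto simp: critical_iff u_def m_def)
  have pos: "?r > 0" "?s > 0" "?t > 0" "?u > 0" "?m > 0" using elim by (auto simp: m_eq)
  define d1 where "d1 = ln (1 + ?r) - ln ?r"
  define d2 where "d2 = ?m / (1 + ?r) - ?u / ?r"
  define d3 where "d3 = Digamma (?m + 1) - Digamma (?u + 1)"
  have 1: "0 \<le> d1" "d1 \<le> 1 / ?r"
    using pos ln_diff_le[of "1 + ?r" ?r] by (auto simp: d1_def)
  \<comment> \<open>The quantities u/r and m/(1+r) would coincide if u were exactly r t; the
    two-sided bound on u measures the defect.\<close>
  have "d2 = (?r * ?t - ?u) / (?r * (1 + ?r))" using pos by (simp add: d2_def m_eq field_simps)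
  moreover have "\<bar>?r * ?t - ?u\<bar> \<le> 1 + ?r" using elim by (auto simp: abs_le_iff algebra_simps)
  then have "\<bar>?r * ?t - ?u\<bar> / (?r * (1 + ?r)) \<le> (1 + ?r) / (?r * (1 + ?r))"
    using pos by (intro divide_right_mono) auto
  ultimately have "\<bar>d2\<bar> \<le> (1 + ?r) / (?r * (1 + ?r))" using pos by (simp add: abs_mult)
  then have 2: "\<bar>d2\<bar> \<le> 1 / ?r" using pos by simp
  have "d3 \<ge> 0" unfolding d3_def using pos Digamma_real_mono[of "?u + 1" "?m + 1"] by (simp add: m_eq)
  moreover have "d3 \<le> 3 / ?r"
  proof -
    have "d3 \<le> ln (?m + 1) - ln ?u"
      unfolding d3_def using pos Digamma_le_ln[of "?m + 1"] ln_le_Digamma_plus1[of ?u] by simp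
    also have "\<dots> \<le> (?m + 1 - ?u) / ?u" using pos by (intro ln_diff_le) auto
    also have "\<dots> = (?t + 1) / ?u" by (simp add: m_eq)
    also have "\<dots> \<le> 3 / ?r"
    proof -
      \<comment> \<open>Combines r t <= u + 1 with 1 <= r <= u.\<close>
      have "?r * (?t + 1) \<le> 3 * ?u" using elim by (auto simp: algebra_simps)
      then show ?thesis using pos by (simp add: field_simps)
    qed
    finally show ?thesis .
  qed
  ultimately have 3: "0 \<le> d3" "d3 \<le> 3 / ?r" by auto
  have abs: "\<bar>- d1 + d2 + d3\<bar> \<le> 5 / ?r" "\<bar>- d1 + d3\<bar> \<le> 5 / ?r" using 1 2 3 pos by (auto simp: abs_le_iff)
  show ?case
  proof (intro allI)
    fix a b
    have "log_summand_d1 (real n) a b ?r ?s = a * (- d1 + d2 + d3) + b * (- d1 + d3)"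
    proof -
      have e: "real n - ?r - ?s = ?m" by (simp add: m_def)
      have "log_summand_d1 (real n) a b ?r ?s =
          a * (- ln (1 + ?r) - ln ?s + ?m / (1 + ?r) - Digamma (?r + 1) + Digamma (?m + 1)) +
          b * (- ln (1 + ?r) - ln ?s + (?m + 1) / ?s - Digamma (?s + 1) + Digamma (?m + 1))"
        unfolding log_summand_d1_def e by (simp add: algebra_simps)
      also have "- ln (1 + ?r) - ln ?s + ?m / (1 + ?r) - Digamma (?r + 1) + Digamma (?m + 1) = - d1 + d2 + d3"
        using c unfolding d1_def d2_def d3_def by linarith
      also have "- ln (1 + ?r) - ln ?s + (?m + 1) / ?s - Digamma (?s + 1) + Digamma (?m + 1) = - d1 + d3"
        using c unfolding d1_def d3_def by linarith
      finally show ?thesis .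
    qed
    also have "\<bar>\<dots>\<bar> \<le> \<bar>a\<bar> * \<bar>- d1 + d2 + d3\<bar> + \<bar>b\<bar> * \<bar>- d1 + d3\<bar>"
      unfolding abs_mult [symmetric] by (rule abs_triangle_ineq)
    also have "\<dots> \<le> \<bar>a\<bar> * (5 / ?r) + \<bar>b\<bar> * (5 / ?r)"
      using abs by (intro add_mono mult_left_mono) auto
    finally show "\<bar>log_summand_d1 (real n) a b ?r ?s\<bar> \<le> (\<bar>a\<bar> + \<bar>b\<bar>) * (5 / ?r)" by (simp only: distrib_right)
  qed
qed

text \<open>Of the second derivative only the two terms with (a/(1+r))^2 and (b/s)^2 survive, each
  carrying a factor close to n that cancels the scaling. The cross term and the trigamma terms
  vanish because r/n and s/n tend to 0. The sequence z stands for the intermediate points of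
  Taylor's formula.\<close>

lemma hessian_limit:
  fixes x y z :: "nat \<Rightarrow> real"
  assumes x: "\<And>n. \<bar>x n\<bar> \<le> K" and y: "\<And>n. \<bar>y n\<bar> \<le> K" and z: "\<And>n. \<bar>z n\<bar> \<le> 1"
  defines "a \<equiv> \<lambda>n. x n * r n / sqrt (real n)" and "b \<equiv> \<lambda>n. y n * s n / sqrt (real n)"
  shows "(\<lambda>n. log_summand_d2 (real n) (a n) (b n) (r n + z n * a n) (s n + z n * b n) + ((x n)\<^sup>2 + (y n)\<^sup>2))
           \<longlonglongrightarrow> 0"
proof -
  define v w where "v n = z n * x n / sqrt (real n)" and "w n = z n * y n / sqrt (real n)" for n
  have K: "K \<ge> 0" using x[of 0] by linarith
  have zx: "\<bar>z n * x n\<bar> \<le> K" "\<bar>z n * y n\<bar> \<le> K" for n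
    using mult_mono[OF z x, of n n] mult_mono[OF z y, of n n] by (auto simp: abs_mult)
  have v: "v \<longlonglongrightarrow> 0" and w: "w \<longlonglongrightarrow> 0"
    using tendsto_mult_bounded_null[OF zx(1) over_sqrt[of 1]] tendsto_mult_bounded_null[OF zx(2) over_sqrt[of 1]]
    by (simp_all add: v_def[abs_def] w_def[abs_def])
  \<comment> \<open>For n large, R, S and M are the ratios r/(1+r'), s/s' and (n-r'-s')/n at the
    displaced point (r', s'), all tending to 1; A below is (a + b)/sqrt n and tends to 0.\<close>
  define R where "R n = 1 / (1 / r n + 1 + v n)" for n
  define S where "S n = 1 / (1 + w n)" for n
  define M where "M n = m n / real n - v n * (r n / real n) - w n * (s n / real n)" for n
  have "R \<longlonglongrightarrow> 1 / (0 + 1 + 0)" unfolding R_def by (intro tendsto_intros inverse_r v) simp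
  then have R: "R \<longlonglongrightarrow> 1" by simp
  have "S \<longlonglongrightarrow> 1 / (1 + 0)" unfolding S_def by (intro tendsto_intros w) simp
  then have S: "S \<longlonglongrightarrow> 1" by simp
  have "M \<longlonglongrightarrow> 1 - 0 * 0 - 0 * 0" unfolding M_def by (intro tendsto_intros m_over_n v w r_over_n s_over_n)
  then have M: "M \<longlonglongrightarrow> 1" by simp
  have n1: "(\<lambda>n::nat. 1 / real n) \<longlonglongrightarrow> 0" by (rule lim_1_over_n)
  define A where "A n = x n * (r n / real n) + y n * (s n / real n)" for n
  have "A \<longlonglongrightarrow> 0 + 0" unfolding A_def
    by (intro tendsto_add tendsto_mult_bounded_null[OF x r_over_n] tendsto_mult_bounded_null[OF y s_over_n])
  then have A: "A \<longlonglongrightarrow> 0" by simp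
  have x2: "\<bar>(x n)\<^sup>2\<bar> \<le> K\<^sup>2" and y2: "\<bar>(y n)\<^sup>2\<bar> \<le> K\<^sup>2" for n
    using power_mono[OF x[of n] abs_ge_zero, of 2] power_mono[OF y[of n] abs_ge_zero, of 2] by auto
  let ?r = "\<lambda>n. r n + z n * a n" and ?s = "\<lambda>n. s n + z n * b n"
  define T4 where "T4 n = (a n)\<^sup>2 * Polygamma 1 (?r n + 1)" for n
  define T5 where "T5 n = (b n)\<^sup>2 * Polygamma 1 (?s n + 1)" for n
  define T6 where "T6 n = (a n + b n)\<^sup>2 * Polygamma 1 (real n - ?r n - ?s n + 1)" for n
  have vw: "\<forall>\<^sub>F n in sequentially. v n > - 1/2" "\<forall>\<^sub>F n in sequentially. w n > - 1/2" "\<forall>\<^sub>F n in sequentially. M n > 1/2"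
    by (rule order_tendstoD(1)[OF v], simp, rule order_tendstoD(1)[OF w], simp, rule order_tendstoD(1)[OF M], simp)
  have ev: "\<forall>\<^sub>F n in sequentially. 0 < sqrt (real n) \<and> r n > 0 \<and> s n > 0 \<and>
      ?r n = r n * (1 + v n) \<and> ?s n = s n * (1 + w n) \<and>
      real n - ?r n - ?s n = M n * real n \<and> a n / (1 + ?r n) = x n / sqrt (real n) * R n \<and>
      b n / ?s n = y n / sqrt (real n) * S n \<and> a n + b n = A n * sqrt (real n) \<and> 1 + v n > 0 \<and> 1 + w n > 0 \<and> M n > 0"
    using ev_basic vw
  proof eventually_elim
    case (elim n)
    define q where "q = sqrt (real n)"
    have q: "q > 0" "real n = q * q" using elim by (auto simp: q_def)
    have pos: "r n > 0" "s n > 0" using elim by auto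
    have er: "?r n = r n * (1 + v n)" and es: "?s n = s n * (1 + w n)"
      by (simp_all add: a_def b_def v_def w_def algebra_simps)
    have "1 / r n > 0" using pos by simp
    then have nz: "1 / r n + 1 + v n > 0" using elim by linarith
    have "a n / (1 + ?r n) = x n * r n / q / (r n * (1 / r n + 1 + v n))"
      unfolding er using pos by (simp add: a_def q_def algebra_simps)
    also have "\<dots> = x n / q * R n" using pos nz by (simp add: R_def)
    finally have e1: "a n / (1 + ?r n) = x n / q * R n" .
    have e2: "b n / ?s n = y n / q * S n" unfolding es using pos elim by (simp add: b_def S_def q_def)
    have e3: "real n - ?r n - ?s n = M n * real n"
      unfolding er es M_def using elim by (simp add: m_def field_simps)
    have e4: "a n + b n = A n * q" unfolding a_def b_def A_def q_def[symmetric] using q by (simp add: field_simps)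
    show ?case using er es e1 e2 e3 e4 pos elim q unfolding q_def by auto
  qed
  have T4: "T4 \<longlonglongrightarrow> 0"
  proof (rule Lim_null_comparison)
    show "\<forall>\<^sub>F n in sequentially. norm (T4 n) \<le> (x n)\<^sup>2 * (r n / real n * (1 / (1 + v n)))"
      using ev
    proof eventually_elim
      case (elim n)
      have p: "?r n > 0" using elim by simp
      have "Polygamma 1 (?r n + 1) > 0" using p by (intro Polygamma_real_odd_pos) (auto intro!: not_nonpos_Ints_pos_real)
      then have "norm (T4 n) = T4 n" by (simp add: T4_def)
      also have "\<dots> \<le> (a n)\<^sup>2 * (1 / ?r n)" unfolding T4_def using p by (intro mult_left_mono Trigamma_plus1_le) auto
      also have "\<dots> = (x n)\<^sup>2 * (r n / real n * (1 / (1 + v n)))"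
        using elim by (simp add: a_def power_divide power_mult_distrib power2_eq_square)
      finally show ?case .
    qed
    have "(\<lambda>n. r n / real n * (1 / (1 + v n))) \<longlonglongrightarrow> 0 * (1 / (1 + 0))" by (intro tendsto_intros r_over_n v) simp
    then show "(\<lambda>n. (x n)\<^sup>2 * (r n / real n * (1 / (1 + v n)))) \<longlonglongrightarrow> 0"
      by (intro tendsto_mult_bounded_null[OF x2]) simp
  qed
  have T5: "T5 \<longlonglongrightarrow> 0"
  proof (rule Lim_null_comparison)
    show "\<forall>\<^sub>F n in sequentially. norm (T5 n) \<le> (y n)\<^sup>2 * (s n / real n * (1 / (1 + w n)))"
      using ev
    proof eventually_elim
      case (elim n)
      have p: "?s n > 0" using elim by simp
      have "Polygamma 1 (?s n + 1) > 0" using p by (intro Polygamma_real_odd_pos) (auto intro!: not_nonpos_Ints_pos_real)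
      then have "norm (T5 n) = T5 n" by (simp add: T5_def)
      also have "\<dots> \<le> (b n)\<^sup>2 * (1 / ?s n)" unfolding T5_def using p by (intro mult_left_mono Trigamma_plus1_le) auto
      also have "\<dots> = (y n)\<^sup>2 * (s n / real n * (1 / (1 + w n)))"
        using elim by (simp add: b_def power_divide power_mult_distrib power2_eq_square)
      finally show ?case .
    qed
    have "(\<lambda>n. s n / real n * (1 / (1 + w n))) \<longlonglongrightarrow> 0 * (1 / (1 + 0))" by (intro tendsto_intros s_over_n w) simp
    then show "(\<lambda>n. (y n)\<^sup>2 * (s n / real n * (1 / (1 + w n)))) \<longlonglongrightarrow> 0"
      by (intro tendsto_mult_bounded_null[OF y2]) simp
  qed
  have T6: "T6 \<longlonglongrightarrow> 0"
  proof (rule Lim_null_comparison)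
    show "\<forall>\<^sub>F n in sequentially. norm (T6 n) \<le> (A n)\<^sup>2 * (1 / M n)"
      using ev
    proof eventually_elim
      case (elim n)
      have p: "M n * real n > 0" using elim by simp
      have "real n - ?r n - ?s n = M n * real n" "a n + b n = A n * sqrt (real n)" using elim by blast+
      then have e: "T6 n = (A n * sqrt (real n))\<^sup>2 * Polygamma 1 (M n * real n + 1)" by (simp only: T6_def)
      have "Polygamma 1 (M n * real n + 1) > 0" using p by (intro Polygamma_real_odd_pos) (auto intro!: not_nonpos_Ints_pos_real)
      then have "norm (T6 n) = T6 n" by (simp add: e)
      also have "\<dots> \<le> (A n * sqrt (real n))\<^sup>2 * (1 / (M n * real n))"
        unfolding e using p by (intro mult_left_mono Trigamma_plus1_le) auto
      also have "\<dots> = (A n)\<^sup>2 * (1 / M n)" using elim by (simp add: power_mult_distrib)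
      finally show ?case .
    qed
    have "(\<lambda>n. (A n)\<^sup>2 * (1 / M n)) \<longlonglongrightarrow> 0\<^sup>2 * (1 / 1)" by (intro tendsto_intros A M) simp
    then show "(\<lambda>n. (A n)\<^sup>2 * (1 / M n)) \<longlonglongrightarrow> 0" by simp
  qed
  have T1: "(\<lambda>n. x n * (A n * R n) + y n * (A n * S n)) \<longlonglongrightarrow> 0"
  proof -
    have "(\<lambda>n. A n * R n) \<longlonglongrightarrow> 0" "(\<lambda>n. A n * S n) \<longlonglongrightarrow> 0"
      using tendsto_mult[OF A R] tendsto_mult[OF A S] by simp_all
    from tendsto_add[OF tendsto_mult_bounded_null[OF x this(1)] tendsto_mult_bounded_null[OF y this(2)]]
    show ?thesis by simp
  qed
  have T2: "(\<lambda>n. (x n)\<^sup>2 * (1 - M n * (R n)\<^sup>2)) \<longlonglongrightarrow> 0"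
  proof -
    have "(\<lambda>n. 1 - M n * (R n)\<^sup>2) \<longlonglongrightarrow> 1 - 1 * 1\<^sup>2" by (intro tendsto_intros M R)
    then show ?thesis by (intro tendsto_mult_bounded_null[OF x2]) simp
  qed
  have T3: "(\<lambda>n. (y n)\<^sup>2 * (1 - (M n + 1 / real n) * (S n)\<^sup>2)) \<longlonglongrightarrow> 0"
  proof -
    have "(\<lambda>n. 1 - (M n + 1 / real n) * (S n)\<^sup>2) \<longlonglongrightarrow> 1 - (1 + 0) * 1\<^sup>2" by (intro tendsto_intros M S n1)
    then show ?thesis by (intro tendsto_mult_bounded_null[OF y2]) simp
  qed
  have "(\<lambda>n. - 2 * (x n * (A n * R n) + y n * (A n * S n)) + (x n)\<^sup>2 * (1 - M n * (R n)\<^sup>2)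
      + (y n)\<^sup>2 * (1 - (M n + 1 / real n) * (S n)\<^sup>2) - T4 n - T5 n - T6 n) \<longlonglongrightarrow> - 2 * 0 + 0 + 0 - 0 - 0 - 0"
    by (intro tendsto_intros T1 T2 T3 T4 T5 T6)
  then have lim: "(\<lambda>n. - 2 * (x n * (A n * R n) + y n * (A n * S n)) + (x n)\<^sup>2 * (1 - M n * (R n)\<^sup>2)
      + (y n)\<^sup>2 * (1 - (M n + 1 / real n) * (S n)\<^sup>2) - T4 n - T5 n - T6 n) \<longlonglongrightarrow> 0" by simp
  show ?thesis
  proof (rule Lim_transform_eventually[OF lim], use ev in eventually_elim)
    case (elim n)
    define q where "q = sqrt (real n)"
    have q: "q > 0" "real n = q * q" using elim by (auto simp: q_def)
    have "M n * real n = M n * (q * q)" using q(2) by simp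
    then have e: "real n - ?r n - ?s n = M n * (q * q)" "a n / (1 + ?r n) = x n / q * R n"
      "b n / ?s n = y n / q * S n" "a n + b n = A n * q"
      using elim unfolding q_def[symmetric] by auto
    have "log_summand_d2 (real n) (a n) (b n) (?r n) (?s n) =
        - 2 * (A n * q) * (x n / q * R n + y n / q * S n)
        - M n * (q * q) * (x n / q * R n)\<^sup>2 - (M n * (q * q) + 1) * (y n / q * S n)\<^sup>2 - T4 n - T5 n - T6 n"
      unfolding log_summand_d2_def T4_def T5_def T6_def e ..
    also have "\<dots> = - 2 * (x n * (A n * R n) + y n * (A n * S n)) - (x n)\<^sup>2 * (M n * (R n)\<^sup>2)
        - (y n)\<^sup>2 * ((M n + 1 / (q * q)) * (S n)\<^sup>2) - T4 n - T5 n - T6 n"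
      using q(1) by (simp add: field_simps power2_eq_square)
    finally show ?case unfolding q(2) by (simp add: algebra_simps)
  qed
qed


text \<open>Second-order Taylor expansion at the critical point in rescaled coordinates. The
  displacements x and y are sequences, so that \<open>eventually_uniform_from_sequences\<close>
  turns the result into uniformity on squares.\<close>

lemma summand_gaussian_limit:
  fixes x y :: "nat \<Rightarrow> real"
  assumes x: "\<And>n. \<bar>x n\<bar> \<le> K" and y: "\<And>n. \<bar>y n\<bar> \<le> K"
  defines "a \<equiv> \<lambda>n. x n * r n / sqrt (real n)" and "b \<equiv> \<lambda>n. y n * s n / sqrt (real n)"
  shows "\<forall>\<^sub>F n in sequentially. 0 \<le> r n + a n \<and> 0 < s n + b n \<and> (r n + a n) + (s n + b n) \<le> real n"
    and "(\<lambda>n. log_summand (real n) (r n + a n) (s n + b n) - log_summand (real n) (r n) (s n)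
            + ((x n)\<^sup>2 + (y n)\<^sup>2) / 2) \<longlonglongrightarrow> 0"
proof -
  have K: "K \<ge> 0" using x[of 0] by linarith
  \<comment> \<open>The displacements are then at most r/2 and s/2, and r + s <= m keeps n - r - s
    nonnegative along the whole segment.\<close>
  have "\<forall>\<^sub>F n in sequentially. K / sqrt (real n) < 1/2" using over_sqrt[of K] by (rule order_tendstoD) simp
  then have dom: "\<forall>\<^sub>F n in sequentially. \<forall>z. 0 \<le> z \<longrightarrow> z \<le> 1 \<longrightarrow>
      0 \<le> r n + z * a n \<and> 0 < s n + z * b n \<and> 0 \<le> real n - (r n + z * a n) - (s n + z * b n)"
    using ev_basic ev_r_plus_s_le_m
  proof eventually_elim
    case (elim n)
    have small: "\<bar>z * (w * c / sqrt (real n))\<bar> \<le> c / 2" if "0 \<le> z" "z \<le> 1" "\<bar>w\<bar> \<le> K" "c > 0" for z w c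
    proof -
      have "\<bar>z * (w * c / sqrt (real n))\<bar> = z * (\<bar>w\<bar> / sqrt (real n)) * c" using that by (simp add: abs_mult)
      also have "\<dots> \<le> 1 * (K / sqrt (real n)) * c"
        using that K by (intro mult_right_mono mult_mono divide_right_mono) auto
      also have "\<dots> \<le> 1/2 * c" using that elim by (intro mult_right_mono) auto
      finally show ?thesis by simp
    qed
    show ?case
    proof (intro allI impI)
      fix z :: real assume z: "0 \<le> z" "z \<le> 1"
      have "\<bar>z * a n\<bar> \<le> r n / 2" "\<bar>z * b n\<bar> \<le> s n / 2"
        unfolding a_def b_def using small[OF z x, of "r n" n] small[OF z y, of "s n" n] elim by auto
      then show "0 \<le> r n + z * a n \<and> 0 < s n + z * b n \<and> 0 \<le> real n - (r n + z * a n) - (s n + z * b n)"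
        using elim unfolding m_def by (auto simp: abs_le_iff)
    qed
  qed
  then show "\<forall>\<^sub>F n in sequentially. 0 \<le> r n + a n \<and> 0 < s n + b n \<and> (r n + a n) + (s n + b n) \<le> real n"
  proof eventually_elim
    case (elim n)
    then show ?case using spec[OF elim, of 1] by simp
  qed
  \<comment> \<open>Stated as an implication so that an intermediate point can be chosen for every
    n; where the segment leaves the domain, z = 0 is a default.\<close>
  have "\<forall>n. \<exists>z. \<bar>z\<bar> \<le> 1 \<and> ((\<forall>z. 0 \<le> z \<longrightarrow> z \<le> 1 \<longrightarrow>
      0 \<le> r n + z * a n \<and> 0 < s n + z * b n \<and> 0 \<le> real n - (r n + z * a n) - (s n + z * b n)) \<longrightarrow>
      log_summand (real n) (r n + a n) (s n + b n) = log_summand (real n) (r n) (s n)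
        + log_summand_d1 (real n) (a n) (b n) (r n) (s n)
        + log_summand_d2 (real n) (a n) (b n) (r n + z * a n) (s n + z * b n) / 2)"
  proof
    fix n
    show "\<exists>z. \<bar>z\<bar> \<le> 1 \<and> ((\<forall>z. 0 \<le> z \<longrightarrow> z \<le> 1 \<longrightarrow>
      0 \<le> r n + z * a n \<and> 0 < s n + z * b n \<and> 0 \<le> real n - (r n + z * a n) - (s n + z * b n)) \<longrightarrow>
      log_summand (real n) (r n + a n) (s n + b n) = log_summand (real n) (r n) (s n)
        + log_summand_d1 (real n) (a n) (b n) (r n) (s n)
        + log_summand_d2 (real n) (a n) (b n) (r n + z * a n) (s n + z * b n) / 2)" (is "\<exists>z. _ \<and> (?dom \<longrightarrow> _ z)")
    proof (cases ?dom)
      case True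
      have "r n + z * a n > - 1 \<and> s n + z * b n > 0 \<and> real n - (r n + z * a n) - (s n + z * b n) > - 1"
        if "0 \<le> z" "z \<le> 1" for z
        using True[rule_format, OF that] by linarith
      then obtain z where "0 < z" "z < 1" "log_summand (real n) (r n + a n) (s n + b n) = log_summand (real n) (r n) (s n)
        + log_summand_d1 (real n) (a n) (b n) (r n) (s n)
        + log_summand_d2 (real n) (a n) (b n) (r n + z * a n) (s n + z * b n) / 2"
        by (rule log_summand_taylor)
      then show ?thesis by (intro exI[of _ z]) simp
    qed (auto intro!: exI[of _ 0])
  qed
  from choice[OF this] obtain z where z: "\<And>n. \<bar>z n\<bar> \<le> 1" and
    taylor: "\<And>n. (\<forall>z. 0 \<le> z \<longrightarrow> z \<le> 1 \<longrightarrow>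
      0 \<le> r n + z * a n \<and> 0 < s n + z * b n \<and> 0 \<le> real n - (r n + z * a n) - (s n + z * b n)) \<Longrightarrow>
      log_summand (real n) (r n + a n) (s n + b n) = log_summand (real n) (r n) (s n)
        + log_summand_d1 (real n) (a n) (b n) (r n) (s n)
        + log_summand_d2 (real n) (a n) (b n) (r n + z n * a n) (s n + z n * b n) / 2" by blast
  have d2: "(\<lambda>n. log_summand_d2 (real n) (a n) (b n) (r n + z n * a n) (s n + z n * b n) + ((x n)\<^sup>2 + (y n)\<^sup>2)) \<longlonglongrightarrow> 0"
    unfolding a_def b_def by (rule hessian_limit[OF x y z])
  \<comment> \<open>The gradient bound 5/r meets displacements K r/sqrt n and K s/sqrt n. The second
    product is rewritten as 5K (s/n)(sqrt n/r), a product of two null sequences.\<close>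
  have d1: "(\<lambda>n. log_summand_d1 (real n) (a n) (b n) (r n) (s n)) \<longlonglongrightarrow> 0"
  proof (rule Lim_null_comparison)
    show "\<forall>\<^sub>F n in sequentially. norm (log_summand_d1 (real n) (a n) (b n) (r n) (s n))
        \<le> 5 * K / sqrt (real n) + 5 * K * ((s n / real n) * (sqrt (real n) / r n))"
      using ev_gradient_bound ev_basic
    proof eventually_elim
      case (elim n)
      define q where "q = sqrt (real n)"
      have q: "q > 0" "real n = q * q" using elim by (auto simp: q_def)
      have pos: "r n > 0" "s n > 0" using elim by auto
      have "\<bar>a n\<bar> * (5 / r n) = \<bar>x n\<bar> * (5 / q)" "\<bar>b n\<bar> * (5 / r n) = \<bar>y n\<bar> * (5 * s n / (q * r n))"
        unfolding a_def b_def q_def[symmetric] using pos q by (simp_all add: abs_mult)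
      moreover have "\<bar>x n\<bar> * (5 / q) \<le> K * (5 / q)" "\<bar>y n\<bar> * (5 * s n / (q * r n)) \<le> K * (5 * s n / (q * r n))"
        using pos q by (intro mult_right_mono x y; simp)+
      moreover have "K * (5 * s n / (q * r n)) = 5 * K * ((s n / (q * q)) * (q / r n))" using q pos by simp
      moreover have "K * (5 / q) = 5 * K / q" by simp
      ultimately have "(\<bar>a n\<bar> + \<bar>b n\<bar>) * (5 / r n) \<le> 5 * K / q + 5 * K * ((s n / (q * q)) * (q / r n))"
        unfolding distrib_right by linarith
      then show ?case using elim(1) unfolding q_def[symmetric] real_norm_def q(2)[symmetric] by (meson order_trans)
    qed
    have "(\<lambda>n. 5 * K / sqrt (real n) + 5 * K * ((s n / real n) * (sqrt (real n) / r n))) \<longlonglongrightarrow> 0 + 5 * K * (0 * 0)"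
      by (intro tendsto_intros over_sqrt s_over_n sqrt_over_r)
    then show "(\<lambda>n. 5 * K / sqrt (real n) + 5 * K * ((s n / real n) * (sqrt (real n) / r n))) \<longlonglongrightarrow> 0" by simp
  qed
  have "(\<lambda>n. log_summand_d1 (real n) (a n) (b n) (r n) (s n) +
      (log_summand_d2 (real n) (a n) (b n) (r n + z n * a n) (s n + z n * b n) + ((x n)\<^sup>2 + (y n)\<^sup>2)) / 2) \<longlonglongrightarrow> 0 + 0 / 2"
    by (intro tendsto_intros d1 d2) simp
  then have lim: "(\<lambda>n. log_summand_d1 (real n) (a n) (b n) (r n) (s n) +
      (log_summand_d2 (real n) (a n) (b n) (r n + z n * a n) (s n + z n * b n) + ((x n)\<^sup>2 + (y n)\<^sup>2)) / 2) \<longlonglongrightarrow> 0"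
    by simp
  show "(\<lambda>n. log_summand (real n) (r n + a n) (s n + b n) - log_summand (real n) (r n) (s n)
            + ((x n)\<^sup>2 + (y n)\<^sup>2) / 2) \<longlonglongrightarrow> 0"
    by (rule Lim_transform_eventually[OF lim], use dom in eventually_elim, drule taylor) (simp add: add_divide_distrib)
qed

text \<open>Laplace's method with meshes sqrt n/r and sqrt n/s, whose product is n/(r s). At a grid
  point the rescaling cancels, so membership in D reads 0 < j and i + j <= n, the range of the
  double sum.\<close>

lemma c_sum_limit:
  "(\<lambda>n. real n / (r n * s n) * (c_sum n / exp (log_summand (real n) (r n) (s n)))) \<longlonglongrightarrow> 2 * pi"
proof -
  define \<alpha> \<beta> where "\<alpha> n = sqrt (real n) / r n" and "\<beta> n = sqrt (real n) / s n" for n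
  define D where "D n = {(x, y). 0 \<le> r n + x / \<alpha> n \<and> 0 < s n + y / \<beta> n \<and> (r n + x / \<alpha> n) + (s n + y / \<beta> n) \<le> real n}" for n
  define f where "f n x y = log_summand (real n) (r n + x / \<alpha> n) (s n + y / \<beta> n) - log_summand (real n) (r n) (s n)" for n x y
  have pos: "\<forall>\<^sub>F n in sequentially. \<alpha> n > 0 \<and> \<beta> n > 0"
    using ev_basic by eventually_elim (auto simp: \<alpha>_def \<beta>_def)
  have "(\<lambda>n. \<alpha> n * \<beta> n * (\<Sum>i=0..n. \<Sum>j=0..n.
            if ((real i - r n) * \<alpha> n, (real j - s n) * \<beta> n) \<in> D n
            then exp (f n ((real i - r n) * \<alpha> n) ((real j - s n) * \<beta> n)) else 0)) \<longlonglongrightarrow> 2 * pi"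
  proof (rule laplace_double_sum)
    show "\<forall>\<^sub>F n in sequentially. \<alpha> n > 0 \<and> \<beta> n > 0" by (rule pos)
    show "\<alpha> \<longlonglongrightarrow> 0" "\<beta> \<longlonglongrightarrow> 0" unfolding \<alpha>_def \<beta>_def by (rule sqrt_over_r sqrt_over_s)+
    show "\<forall>\<^sub>F n in sequentially. \<forall>x y l. (x, y) \<in> D n \<longrightarrow> 0 \<le> l \<longrightarrow> l \<le> 1 \<longrightarrow> l * f n x y \<le> f n (l * x) (l * y)"
      using ev_basic
    proof eventually_elim
      case (elim n)
      show ?case
      proof (intro allI impI)
        fix x y l assume xy: "(x, y) \<in> D n" and l: "0 \<le> l" "l \<le> (1::real)"
        have "(1 - l) * log_summand (real n) (r n) (s n) + l * log_summand (real n) (r n + x / \<alpha> n) (s n + y / \<beta> n)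
           \<le> log_summand (real n) (r n + l * ((r n + x / \<alpha> n) - r n)) (s n + l * ((s n + y / \<beta> n) - s n))"
          by (rule log_summand_concave_on_segment) (use xy l elim in \<open>auto simp: D_def u_def\<close>)
        then show "l * f n x y \<le> f n (l * x) (l * y)" by (simp add: f_def algebra_simps)
      qed
    qed
    show "\<forall>\<^sub>F n in sequentially. \<forall>i j :: int. ((of_int i - r n) * \<alpha> n, (of_int j - s n) * \<beta> n) \<in> D n \<longrightarrow>
        0 \<le> i \<and> i \<le> int n \<and> 0 \<le> j \<and> j \<le> int n"
      using pos
    proof eventually_elim
      case (elim n)
      show ?case
      proof (intro allI impI)
        fix i j :: int assume "((of_int i - r n) * \<alpha> n, (of_int j - s n) * \<beta> n) \<in> D n"
        then have "0 \<le> real_of_int i" "0 < real_of_int j" "real_of_int i + real_of_int j \<le> real n"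
          using elim by (auto simp: D_def)
        then show "0 \<le> i \<and> i \<le> int n \<and> 0 \<le> j \<and> j \<le> int n" by linarith
      qed
    qed
    fix K e :: real assume Ke: "K > 0" "e > 0"
    show "\<forall>\<^sub>F n in sequentially. \<forall>x y. \<bar>x\<bar> \<le> K \<longrightarrow> \<bar>y\<bar> \<le> K \<longrightarrow>
        (x, y) \<in> D n \<and> \<bar>f n x y + (x\<^sup>2 + y\<^sup>2) / 2\<bar> \<le> e"
    proof (rule eventually_uniform_from_sequences)
      fix x y :: "nat \<Rightarrow> real" assume xy: "\<And>n. \<bar>x n\<bar> \<le> K" "\<And>n. \<bar>y n\<bar> \<le> K"
      note lim = summand_gaussian_limit[of x K y, OF xy]
      have "\<forall>\<^sub>F n in sequentially. \<bar>f n (x n) (y n) + ((x n)\<^sup>2 + (y n)\<^sup>2) / 2\<bar> < e"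
        using tendstoD[OF lim(2) Ke(2)] by (simp add: f_def \<alpha>_def \<beta>_def dist_real_def)
      then show "\<forall>\<^sub>F n in sequentially. (x n, y n) \<in> D n \<and> \<bar>f n (x n) (y n) + ((x n)\<^sup>2 + (y n)\<^sup>2) / 2\<bar> \<le> e"
        using lim(1) by eventually_elim (simp add: D_def \<alpha>_def \<beta>_def)
    qed (use Ke in simp)
  qed
  moreover have "\<forall>\<^sub>F n in sequentially. \<alpha> n * \<beta> n * (\<Sum>i=0..n. \<Sum>j=0..n.
            if ((real i - r n) * \<alpha> n, (real j - s n) * \<beta> n) \<in> D n
            then exp (f n ((real i - r n) * \<alpha> n) ((real j - s n) * \<beta> n)) else 0) =
      real n / (r n * s n) * (c_sum n / exp (log_summand (real n) (r n) (s n)))"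
    using pos
  proof eventually_elim
    case (elim n)
    have "(\<Sum>i=0..n. \<Sum>j=0..n.
            if ((real i - r n) * \<alpha> n, (real j - s n) * \<beta> n) \<in> D n
            then exp (f n ((real i - r n) * \<alpha> n) ((real j - s n) * \<beta> n)) else 0) =
          (\<Sum>i=0..n. \<Sum>j=0..n. (if 0 < j \<and> i + j \<le> n
            then exp (log_summand (real n) (real i) (real j)) else 0) / exp (log_summand (real n) (r n) (s n)))"
    proof (intro sum.cong refl)
      fix i j :: nat
      have "real i + real j \<le> real n \<longleftrightarrow> i + j \<le> n" by linarith
      then show "(if ((real i - r n) * \<alpha> n, (real j - s n) * \<beta> n) \<in> D n
            then exp (f n ((real i - r n) * \<alpha> n) ((real j - s n) * \<beta> n)) else 0) =
          (if 0 < j \<and> i + j \<le> n then exp (log_summand (real n) (real i) (real j)) else 0)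
            / exp (log_summand (real n) (r n) (s n))"
        using elim by (simp add: D_def f_def exp_diff)
    qed
    also have "\<dots> = c_sum n / exp (log_summand (real n) (r n) (s n))"
      by (simp only: c_sum_eq_double_sum sum_divide_distrib)
    finally show ?case by (simp add: \<alpha>_def \<beta>_def)
  qed
  ultimately show ?thesis by (rule Lim_transform_eventually)
qed

section \<open>Comparison of the double-sum summand with F\<close>

lemma F_term_eq_exp:
  assumes "critical n (r n) (s n) (t n)"
  shows "F_term n (r n) (s n) (t n) = exp (ln_Gamma (real n + 1) + u n * ln (r n) + (m n + 1) * ln (s n)
     - ln_Gamma (r n + 1) - ln_Gamma (s n + 1) - ln_Gamma (t n + 1) - ln_Gamma (u n + 1))"
proof -
  have pos: "r n > 0" "s n > 0" "t n > 0" "u n > 0" using assms by (auto simp: critical_def u_def)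
  have "Gamma (x + 1) = exp (ln_Gamma (x + 1))" if "x \<ge> 0" for x :: real
    using that by (intro Gamma_real_pos_exp) auto
  then show ?thesis
    unfolding F_term_def u_def[symmetric] m_def[symmetric] rpow_def
    using pos by (simp add: powr_def exp_add exp_diff m_eq)
qed

text \<open>The summand divided by F is the reciprocal of the binomial probability of t in m trials
  with success probability 1/(1+r), for real t and m. Stirling's formula at t, u and m turns it into
  sqrt(2 pi t u/m) exp(E), up to a factor tending to 1. Here u/m tends to 1, and E is at most 4r/m
  since |t r - u| <= 2r.\<close>

lemma summand_over_F_limit:
  "(\<lambda>n. exp (log_summand (real n) (r n) (s n)) / (F_term n (r n) (s n) (t n) * sqrt (t n))) \<longlonglongrightarrow> sqrt (2 * pi)"
proof -
  define E where "E n = t n * ln (t n) + u n * ln (u n) - m n * ln (m n) + m n * ln (1 + r n) - u n * ln (r n)" for n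
  have E: "E \<longlonglongrightarrow> 0"
  proof (rule Lim_null_comparison)
    show "\<forall>\<^sub>F n in sequentially. norm (E n) \<le> 4 * ((r n / real n) / (m n / real n))"
      using ev_basic
    proof eventually_elim
      case (elim n)
      have b: "0 \<le> E n" "E n \<le> (t n * r n - u n)\<^sup>2 / (m n * r n)"
        using binomial_entropy_bounds[of "t n" "u n" "r n"] elim unfolding E_def m_eq
        by (auto simp: add.commute)
      have "\<bar>t n * r n - u n\<bar> \<le> 2 * r n" using elim by (auto simp: abs_le_iff algebra_simps)
      then have "\<bar>t n * r n - u n\<bar>\<^sup>2 \<le> (2 * r n)\<^sup>2" by (intro power_mono) auto
      then have "(t n * r n - u n)\<^sup>2 / (m n * r n) \<le> (2 * r n)\<^sup>2 / (m n * r n)"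
        using elim by (intro divide_right_mono) (auto simp: m_eq)
      also have "\<dots> = 4 * ((r n / real n) / (m n / real n))" using elim by (simp add: power2_eq_square)
      finally show ?case using b by simp
    qed
    have "(\<lambda>n. 4 * ((r n / real n) / (m n / real n))) \<longlonglongrightarrow> 4 * (0 / 1)"
      by (intro tendsto_intros r_over_n m_over_n) simp
    then show "(\<lambda>n. 4 * ((r n / real n) / (m n / real n))) \<longlonglongrightarrow> 0" by simp
  qed
  have st: "(\<lambda>n. stirling_err (t n)) \<longlonglongrightarrow> ln (2 * pi) / 2" "(\<lambda>n. stirling_err (u n)) \<longlonglongrightarrow> ln (2 * pi) / 2"
    "(\<lambda>n. stirling_err (m n)) \<longlonglongrightarrow> ln (2 * pi) / 2"
    by (rule filterlim_compose[OF tendsto_stirling_err t_at_top] filterlim_compose[OF tendsto_stirling_err u_at_top]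
        filterlim_compose[OF tendsto_stirling_err m_at_top])+
  have um: "(\<lambda>n. ln ((u n / real n) / (m n / real n)) / 2) \<longlonglongrightarrow> ln (1 / 1) / 2"
    by (intro tendsto_intros u_over_n m_over_n) simp_all
  have "(\<lambda>n. exp (stirling_err (t n) + stirling_err (u n) - stirling_err (m n) + E n
      + ln ((u n / real n) / (m n / real n)) / 2)) \<longlonglongrightarrow>
      exp (ln (2 * pi) / 2 + ln (2 * pi) / 2 - ln (2 * pi) / 2 + 0 + ln (1 / 1) / 2)"
    by (intro tendsto_exp tendsto_add tendsto_diff st E um)
  also have "exp (ln (2 * pi) / 2 + ln (2 * pi) / 2 - ln (2 * pi) / 2 + 0 + ln (1 / 1) / 2) = sqrt (2 * pi)"
    by (simp add: ln_sqrt [symmetric])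
  finally show ?thesis
  proof (rule Lim_transform_eventually, use ev_basic in eventually_elim)
    case (elim n)
    have pos: "r n > 0" "s n > 0" "t n > 0" "u n > 0" "m n > 0" using elim by (auto simp: m_eq)
    have g: "ln_Gamma (x + 1) = stirling_err x + (x + 1/2) * ln x - x" for x by (simp add: stirling_err_def)
    have lum: "ln ((u n / real n) / (m n / real n)) = ln (u n) - ln (m n)"
      using pos elim by (simp add: ln_div)
    have sq: "sqrt (t n) = exp (ln (t n) / 2)" using pos by (simp add: ln_sqrt [symmetric])
    have "exp (log_summand (real n) (r n) (s n)) / (F_term n (r n) (s n) (t n) * sqrt (t n)) =
      exp (log_summand (real n) (r n) (s n) - ((ln_Gamma (real n + 1) + u n * ln (r n) + (m n + 1) * ln (s n)
     - ln_Gamma (r n + 1) - ln_Gamma (s n + 1) - ln_Gamma (t n + 1) - ln_Gamma (u n + 1)) + ln (t n) / 2))"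
      using elim F_term_eq_exp[of n] unfolding sq by (simp only: exp_diff exp_add)
    also have "log_summand (real n) (r n) (s n) - ((ln_Gamma (real n + 1) + u n * ln (r n) + (m n + 1) * ln (s n)
     - ln_Gamma (r n + 1) - ln_Gamma (s n + 1) - ln_Gamma (t n + 1) - ln_Gamma (u n + 1)) + ln (t n) / 2) =
      stirling_err (t n) + stirling_err (u n) - stirling_err (m n) + E n
      + ln ((u n / real n) / (m n / real n)) / 2"
      unfolding log_summand_def m_def[symmetric] lum g[of "t n"] g[of "u n"] g[of "m n"] E_def
      by (simp add: algebra_simps) (simp add: m_eq diff_divide_distrib)
    finally show ?case by simp
  qed
qed

text \<open>Multiplies the two limits: 2 pi from the sum over (r, s) and sqrt(2 pi) from the
  comparison with F.\<close>

lemma c_sum_asymp_equiv: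
  "c_sum \<sim>[sequentially]
     (\<lambda>n. F_term n (r n) (s n) (t n) * ((2 * pi) powr (3 / 2) * r n * s n * sqrt (t n) / real n))"
proof (rule asymp_equivI')
  let ?G = "\<lambda>n. exp (log_summand (real n) (r n) (s n))"
  have "(\<lambda>n. real n / (r n * s n) * (c_sum n / ?G n) * (?G n / (F_term n (r n) (s n) (t n) * sqrt (t n)))
      / (2 * pi) powr (3/2)) \<longlonglongrightarrow> 2 * pi * sqrt (2 * pi) / (2 * pi) powr (3/2)"
    by (intro tendsto_intros c_sum_limit summand_over_F_limit) simp
  also have "2 * pi * sqrt (2 * pi) / (2 * pi) powr (3/2) = 1"
  proof -
    have "(2 * pi) powr (3/2) = (2 * pi) powr (1 + 1/2)" by simp
    also have "\<dots> = 2 * pi * sqrt (2 * pi)" by (subst powr_add) (simp add: powr_half_sqrt)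
    finally show ?thesis by simp
  qed
  finally show "(\<lambda>n. c_sum n / (F_term n (r n) (s n) (t n) * ((2 * pi) powr (3 / 2) * r n * s n * sqrt (t n) / real n)))
      \<longlonglongrightarrow> 1"
    by (simp add: mult_ac)
qed

end

theorem theorem32:
  "(\<forall>\<^sub>F n in sequentially. \<exists>!(r, s, t). critical n r s t) \<and>
   (\<forall>r s t :: nat \<Rightarrow> real.
      (\<forall>\<^sub>F n in sequentially. critical n (r n) (s n) (t n)) \<longrightarrow>
      c_sum \<sim>[sequentially]
        (\<lambda>n. F_term n (r n) (s n) (t n) * ((2 * pi) powr (3 / 2) * r n * s n * sqrt (t n) / real n)))"
  using eventually_ex1_critical critical_sequence.c_sum_asymp_equiv
  by (simp add: critical_sequence_def)

end
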